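(* Let $n\ge 2$, and let $\mathcal{PMCG}(\mathbb{R}P^2,n)\cong P_n(\mathbb{R}P^2)/\langle\Delta_n^2\rangle$ be the pure mapping class group of the real projective plane with $n$ marked points. Let $a=\rho_n\sigma_{n-1}\cdots\sigma_1$ and $b=\rho_{n-1}\sigma_{n-2}\cdots\sigma_1$ in $B_n(\mathbb{R}P^2)$, and let $\overline{a},\overline{b}$ be their images in $\mathcal{MCG}(\mathbb{R}P^2,n)\cong B_n(\mathbb{R}P^2)/\langle\Delta_n^2\rangle$. Then $\mathcal{PMCG}(\mathbb{R}P^2,n)$ is torsion generated by the set of torsion elements $$\{\overline{a}^{\,n},\ \overline{b}^{\,n-1},\ \overline{a}\,\overline{b}^{\,n-1}\overline{a}^{\,-1},\ \ldots,\ \overline{a}^{\,n-2}\,\overline{b}^{\,n-1}\overline{a}^{\,2-n}\}$$ of order $2$, and $$\operatorname{G}(\mathcal{PMCG}(\mathbb{R}P^2,n))=\operatorname{NG}(\mathcal{PMCG}(\mathbb{R}P^2,n))=\operatorname{TG}(\mathcal{PMCG}(\mathbb{R}P^2,n))=\operatorname{NTG}(\mathcal{PMCG}(\mathbb{R}P^2,n))=n.$$ In particular, $\mathcal{PMCG}(\mathbb{R}P^2,n)$ cannot be normally generated by any subset containing less than $n$ elements.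
   Context: $\mathcal{MCG}(\mathbb{R}P^2,n)$ is the group of isotopy classes of homeomorphisms of $\mathbb{R}P^2$ leaving a given $n$-point set $X$ invariant, with isotopies fixing $X$ pointwise; $\mathcal{PMCG}(\mathbb{R}P^2,n)$ is the normal subgroup given by homeomorphisms fixing $X$ pointwise. For $n\ge 2$ they are identified with $B_n(\mathbb{R}P^2)/\langle\Delta_n^2\rangle$ and $P_n(\mathbb{R}P^2)/\langle\Delta_n^2\rangle$ respectively, where $\Delta_n^2=(\sigma_1\cdots\sigma_{n-1})^n$ is the full twist (central of order $2$). The group $B_n(\mathbb{R}P^2)=\pi_1(F_n(\mathbb{R}P^2)/S_n)$, where $F_n(\mathbb{R}P^2)$ is the space of ordered $n$-tuples of distinct points, has a presentation (Van Buskirk) with generators $\sigma_1,\dots,\sigma_{n-1},\rho_1,\dots,\rho_n$ and relations: $\sigma_i\sigma_j=\sigma_j\sigma_i$ if $|i-j|\ge2$; $\sigma_i\sigma_{i+1}\sigma_i=\sigma_{i+1}\sigma_i\sigma_{i+1}$ for $1\le i\le n-2$; $\sigma_i\rho_j=\rho_j\sigma_i$ for $j\ne i,i+1$; $\rho_{i+1}=\sigma_i^{-1}\rho_i\sigma_i^{-1}$ for $1\le i\le n-1$; $\rho_{i+1}^{-1}\rho_i^{-1}\rho_{i+1}\rho_i=\sigma_i^2$ for $1\le i\le n-1$; $\rho_1^2=\sigma_1\sigma_2\cdots\sigma_{n-2}\sigma_{n-1}^2\sigma_{n-2}\cdots\sigma_2\sigma_1$. $P_n(\mathbb{R}P^2)=\pi_1(F_n(\mathbb{R}P^2))$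 is the kernel of the homomorphism to $S_n$ sending $\sigma_i$ to $(i,i+1)$ and each $\rho_j$ to the identity. For a group $\Gamma$, $\operatorname{G}(\Gamma)$ (resp. $\operatorname{NG}(\Gamma)$) is the minimal cardinality of a subset $X\subset\Gamma$ such that the subgroup generated by $X$ (resp. the normal closure of $X$) is $\Gamma$. $\operatorname{TG}(\Gamma)$ (resp. $\operatorname{NTG}(\Gamma)$) is the minimal cardinality of a subset $X\subset\Gamma$ consisting of elements of finite order such that the subgroup generated by $X$ (resp. the normal closure of $X$) is $\Gamma$. $\Gamma$ is torsion generated by $X$ if $X$ consists of elements of finite order and generates $\Gamma$; it is normally generated by $X$ if the normal closure of $X$ is $\Gamma$. *)

theory Defs
  imports
    "HOL-Analysis.Analysis"
    "HOL-Library.Extended_Nat"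
    "HOL-Algebra.Bij"
    "HOL-Algebra.Coset"
    "HOL-Algebra.Generated_Groups"
    "HOL-Algebra.Multiplicative_Group"
    "HOL-Algebra.Sym_Groups"
begin

section \<open>Minimal cardinalities of generating sets\<close>

definition normal_closure :: "('a, 'b) monoid_scheme \<Rightarrow> 'a set \<Rightarrow> 'a set" where
  "normal_closure G X = \<Inter> {N. N \<lhd> G \<and> X \<subseteq> N}"

definition finite_order :: "('a, 'b) monoid_scheme \<Rightarrow> 'a \<Rightarrow> bool" where
  "finite_order G x \<longleftrightarrow> (\<exists>k::nat. k > 0 \<and> x [^]\<^bsub>G\<^esub> k = \<one>\<^bsub>G\<^esub>)"

definition generated_by :: "('a, 'b) monoid_scheme \<Rightarrow> 'a set \<Rightarrow> bool" where
  "generated_by G X \<longleftrightarrow> X \<subseteq> carrier G \<and> generate G X = carrier G"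

definition normally_generated_by :: "('a, 'b) monoid_scheme \<Rightarrow> 'a set \<Rightarrow> bool" where
  "normally_generated_by G X \<longleftrightarrow> X \<subseteq> carrier G \<and> normal_closure G X = carrier G"

definition torsion_generated_by :: "('a, 'b) monoid_scheme \<Rightarrow> 'a set \<Rightarrow> bool" where
  "torsion_generated_by G X \<longleftrightarrow> generated_by G X \<and> (\<forall>x\<in>X. finite_order G x)"

definition normally_torsion_generated_by :: "('a, 'b) monoid_scheme \<Rightarrow> 'a set \<Rightarrow> bool" where
  "normally_torsion_generated_by G X \<longleftrightarrow>
     normally_generated_by G X \<and> (\<forall>x\<in>X. finite_order G x)"

text \<open>The value is \<open>\<infinity>\<close> if no finite set satisfies the property; hence a finite value is attained
  by some finite set.\<close>

definition min_card :: "('a set \<Rightarrow> bool) \<Rightarrow> enat" where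
  "min_card Q = (INF X \<in> {X. Q X}. if finite X then enat (card X) else \<infinity>)"

definition G_rank :: "('a, 'b) monoid_scheme \<Rightarrow> enat" where
  "G_rank G = min_card (generated_by G)"

definition NG_rank :: "('a, 'b) monoid_scheme \<Rightarrow> enat" where
  "NG_rank G = min_card (normally_generated_by G)"

definition TG_rank :: "('a, 'b) monoid_scheme \<Rightarrow> enat" where
  "TG_rank G = min_card (torsion_generated_by G)"

definition NTG_rank :: "('a, 'b) monoid_scheme \<Rightarrow> enat" where
  "NTG_rank G = min_card (normally_torsion_generated_by G)"


section \<open>Groups given by generators and relations\<close>

text \<open>The letter \<open>(g, True)\<close> stands for the generator \<open>g\<close>, and \<open>(g, False)\<close> for its inverse. A
  relation \<open>u = v\<close> is the pair \<open>(u, v)\<close>.\<close>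

type_synonym 'g word = "('g \<times> bool) list"

inductive word_cong :: "'g set \<Rightarrow> ('g word \<times> 'g word) set \<Rightarrow> 'g word \<Rightarrow> 'g word \<Rightarrow> bool"
  for S :: "'g set" and R :: "('g word \<times> 'g word) set"
where
  rel: "(u, v) \<in> R \<Longrightarrow> word_cong S R u v"
| cancel: "g \<in> S \<Longrightarrow> word_cong S R [(g, e), (g, \<not> e)] []"
| refl: "word_cong S R u u"
| sym: "word_cong S R u v \<Longrightarrow> word_cong S R v u"
| trans: "word_cong S R u v \<Longrightarrow> word_cong S R v w \<Longrightarrow> word_cong S R u w"
| append: "word_cong S R u u' \<Longrightarrow> word_cong S R v v' \<Longrightarrow> word_cong S R (u @ v) (u' @ v')"

definition words_over :: "'g set \<Rightarrow> 'g word set" where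
  "words_over S = lists (S \<times> UNIV)"

definition word_class :: "'g set \<Rightarrow> ('g word \<times> 'g word) set \<Rightarrow> 'g word \<Rightarrow> 'g word set" where
  "word_class S R u = {v \<in> words_over S. word_cong S R u v}"

definition presented_group :: "'g set \<Rightarrow> ('g word \<times> 'g word) set \<Rightarrow> 'g word set monoid" where
  "presented_group S R =
     \<lparr>carrier = word_class S R ` words_over S,
      mult = \<lambda>A B. \<Union>u\<in>A. \<Union>v\<in>B. word_class S R (u @ v),
      one = word_class S R []\<rparr>"

lemma word_class_eq_iff:
  assumes "u \<in> words_over S" "v \<in> words_over S"
  shows "word_class S R u = word_class S R v \<longleftrightarrow> word_cong S R u v"
proof
  assume "word_class S R u = word_class S R v"
  moreover have "v \<in> word_class S R v"
    using assms by (simp add: word_class_def word_cong.refl)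
  ultimately show "word_cong S R u v"
    by (auto simp: word_class_def)
next
  assume uv: "word_cong S R u v"
  have "word_cong S R u w \<longleftrightarrow> word_cong S R v w" for w
    using word_cong.trans[OF uv] word_cong.trans[OF word_cong.sym[OF uv]] by blast
  then show "word_class S R u = word_class S R v"
    by (simp add: word_class_def)
qed

lemma presented_group_mult:
  assumes "u \<in> words_over S" "v \<in> words_over S"
  shows "word_class S R u \<otimes>\<^bsub>presented_group S R\<^esub> word_class S R v = word_class S R (u @ v)"
proof -
  let ?A = "word_class S R u" and ?B = "word_class S R v"
  have eq: "word_class S R (u' @ v') = word_class S R (u @ v)" if uv': "u' \<in> ?A" "v' \<in> ?B" for u' v'
  proof -
    have "word_cong S R u u'" "word_cong S R v v'" "u' @ v' \<in> words_over S" "u @ v \<in> words_over S"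
      using uv' assms by (simp_all add: word_class_def words_over_def)
    then show ?thesis
      using word_class_eq_iff[of "u @ v" S "u' @ v'" R] word_cong.append[of S R u u' v v'] by simp
  qed
  have "(\<Union>u'\<in>?A. \<Union>v'\<in>?B. word_class S R (u' @ v')) =
        (\<Union>u'\<in>?A. \<Union>v'\<in>?B. word_class S R (u @ v))"
    by (intro SUP_cong HOL.refl) (rule eq)
  moreover have "u \<in> ?A" "v \<in> ?B"
    using assms by (simp_all add: word_class_def word_cong.refl)
  then have "?A \<noteq> {}" "?B \<noteq> {}"
    by blast+
  ultimately show ?thesis
    by (simp add: presented_group_def)
qed

lemma word_inverse:
  assumes "u \<in> words_over S"
  shows "word_cong S R (map (\<lambda>(g, e). (g, \<not> e)) (rev u) @ u) []"
  using assms
proof (induction u)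
  case Nil
  then show ?case by (simp add: word_cong.refl)
next
  case (Cons x u)
  obtain g e where x: "x = (g, e)" by (cases x)
  let ?i = "\<lambda>w. map (\<lambda>(g, e). (g, \<not> e)) (rev w) :: 'a word"
  have g: "g \<in> S" and u: "u \<in> words_over S"
    using Cons.prems x by (auto simp: words_over_def)
  have "word_cong S R ([(g, \<not> e), (g, e)] @ u) ([] @ u)"
    using word_cong.cancel[OF g, of R "\<not> e"] by (intro word_cong.append word_cong.refl) simp_all
  then have "word_cong S R (?i u @ ([(g, \<not> e), (g, e)] @ u)) (?i u @ u)"
    by (intro word_cong.append word_cong.refl) simp_all
  then show ?case
    using Cons.IH[OF u] x by (auto intro: word_cong.trans)
qed

lemma group_presented_group: "group (presented_group S R)"
proof (rule groupI)
  let ?G = "presented_group S R"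
  have c: "carrier ?G = word_class S R ` words_over S"
    and o: "\<one>\<^bsub>?G\<^esub> = word_class S R []"
    by (simp_all add: presented_group_def)
  have ap: "u @ v \<in> words_over S" if "u \<in> words_over S" "v \<in> words_over S" for u v :: "'a word"
    using that by (simp add: words_over_def)
  have nil: "[] \<in> words_over S"
    by (simp add: words_over_def)
  show "\<one>\<^bsub>?G\<^esub> \<in> carrier ?G"
    using nil by (simp add: c o)
  show "x \<otimes>\<^bsub>?G\<^esub> y \<in> carrier ?G" if "x \<in> carrier ?G" "y \<in> carrier ?G" for x y
    using that by (auto simp: c presented_group_mult ap)
  show "x \<otimes>\<^bsub>?G\<^esub> y \<otimes>\<^bsub>?G\<^esub> z = x \<otimes>\<^bsub>?G\<^esub> (y \<otimes>\<^bsub>?G\<^esub> z)"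
    if "x \<in> carrier ?G" "y \<in> carrier ?G" "z \<in> carrier ?G" for x y z
    using that by (auto simp: c presented_group_mult ap)
  show "\<one>\<^bsub>?G\<^esub> \<otimes>\<^bsub>?G\<^esub> x = x" if "x \<in> carrier ?G" for x
    using that nil by (auto simp: c o presented_group_mult)
  show "\<exists>y\<in>carrier ?G. y \<otimes>\<^bsub>?G\<^esub> x = \<one>\<^bsub>?G\<^esub>" if x: "x \<in> carrier ?G" for x
  proof -
    obtain u where u: "u \<in> words_over S" "x = word_class S R u"
      using x by (auto simp: c)
    let ?v = "map (\<lambda>(g, e). (g, \<not> e)) (rev u)"
    have v: "?v \<in> words_over S"
      using u(1) by (force simp: words_over_def)
    then have "word_class S R ?v \<otimes>\<^bsub>?G\<^esub> x = \<one>\<^bsub>?G\<^esub>"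
      using u nil word_inverse[OF u(1), of R] ap[OF v u(1)]
      by (simp add: presented_group_mult o word_class_eq_iff)
    then show ?thesis
      using v by (auto simp: c)
  qed
qed


section \<open>Braid groups of the projective plane\<close>

datatype braid_gen = BSigma nat | BRho nat

abbreviation sg :: "nat \<Rightarrow> braid_gen \<times> bool" where "sg i \<equiv> (BSigma i, True)"
abbreviation sg_inv :: "nat \<Rightarrow> braid_gen \<times> bool" where "sg_inv i \<equiv> (BSigma i, False)"
abbreviation rh :: "nat \<Rightarrow> braid_gen \<times> bool" where "rh i \<equiv> (BRho i, True)"
abbreviation rh_inv :: "nat \<Rightarrow> braid_gen \<times> bool" where "rh_inv i \<equiv> (BRho i, False)"

definition braid_gens :: "nat \<Rightarrow> braid_gen set" where
  "braid_gens n = BSigma ` {1..n - 1} \<union> BRho ` {1..n}"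

text \<open>Van Buskirk's relations.\<close>

definition braid_rels :: "nat \<Rightarrow> (braid_gen word \<times> braid_gen word) set" where
  "braid_rels n =
     {([sg i, sg j], [sg j, sg i]) | i j.
        i \<in> {1..n - 1} \<and> j \<in> {1..n - 1} \<and> \<bar>int i - int j\<bar> \<ge> 2}
   \<union> {([sg i, sg (i + 1), sg i], [sg (i + 1), sg i, sg (i + 1)]) | i. i \<in> {1..n - 2}}
   \<union> {([sg i, rh j], [rh j, sg i]) | i j.
        i \<in> {1..n - 1} \<and> j \<in> {1..n} \<and> j \<noteq> i \<and> j \<noteq> i + 1}
   \<union> {([rh (i + 1)], [sg_inv i, rh i, sg_inv i]) | i. i \<in> {1..n - 1}}
   \<union> {([rh_inv (i + 1), rh_inv i, rh (i + 1), rh i], [sg i, sg i]) | i. i \<in> {1..n - 1}}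
   \<union> {([rh 1, rh 1], map sg [1..<n] @ map sg (rev [1..<n]))}"

definition RP2_braid_group :: "nat \<Rightarrow> braid_gen word set monoid" where
  "RP2_braid_group n = presented_group (braid_gens n) (braid_rels n)"

definition braid_of :: "nat \<Rightarrow> braid_gen word \<Rightarrow> braid_gen word set" where
  "braid_of n = word_class (braid_gens n) (braid_rels n)"

fun letter_perm :: "braid_gen \<times> bool \<Rightarrow> nat \<Rightarrow> nat" where
  "letter_perm (BSigma i, e) = Transposition.transpose i (i + 1)"
| "letter_perm (BRho j, e) = id"

definition word_perm :: "braid_gen word \<Rightarrow> nat \<Rightarrow> nat" where
  "word_perm w = foldr (\<lambda>x p. letter_perm x \<circ> p) w id"

text \<open>All words in a braid have the same permutation, so that \<open>the_elem\<close> picks the common value.\<close>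

definition braid_perm :: "braid_gen word set \<Rightarrow> nat \<Rightarrow> nat" where
  "braid_perm A = the_elem (word_perm ` A)"

definition RP2_pure_braids :: "nat \<Rightarrow> braid_gen word set set" where
  "RP2_pure_braids n = kernel (RP2_braid_group n) (sym_group n) braid_perm"

definition full_twist :: "nat \<Rightarrow> braid_gen word set" where
  "full_twist n = braid_of n (concat (replicate n (map sg [1..<n])))"

definition full_twist_subgroup :: "nat \<Rightarrow> braid_gen word set set" where
  "full_twist_subgroup n = generate (RP2_braid_group n) {full_twist n}"

definition braid_a :: "nat \<Rightarrow> braid_gen word set" where
  "braid_a n = braid_of n (rh n # map sg (rev [1..<n]))"

definition braid_b :: "nat \<Rightarrow> braid_gen word set" where
  "braid_b n = braid_of n (rh (n - 1) # map sg (rev [1..<n - 1]))"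

definition braid_MCG :: "nat \<Rightarrow> braid_gen word set set monoid" where
  "braid_MCG n = RP2_braid_group n Mod full_twist_subgroup n"

definition braid_PMCG :: "nat \<Rightarrow> braid_gen word set set monoid" where
  "braid_PMCG n = (RP2_braid_group n)\<lparr>carrier := RP2_pure_braids n\<rparr> Mod full_twist_subgroup n"

definition MCG_image :: "nat \<Rightarrow> braid_gen word set \<Rightarrow> braid_gen word set set" where
  "MCG_image n x = full_twist_subgroup n #>\<^bsub>RP2_braid_group n\<^esub> x"

lemma word_perm_append: "word_perm (u @ v) = word_perm u \<circ> word_perm v"
  by (induction u) (auto simp: word_perm_def fun_eq_iff)

lemma word_perm_map_sg_rev: "word_perm (map sg is @ map sg (rev is)) = id"
proof (induction "is")
  case (Cons i "is")
  have "word_perm (map sg (i # is) @ map sg (rev (i # is))) =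
        Transposition.transpose i (i + 1) \<circ> word_perm (map sg is @ map sg (rev is)) \<circ>
          Transposition.transpose i (i + 1)"
    using word_perm_append[of "map sg is @ map sg (rev is)" "[sg i]"]
    by (simp add: word_perm_def comp_assoc)
  then show ?case using Cons by simp
qed (simp add: word_perm_def)

lemma transpose_commute:
  fixes i j :: nat
  assumes "\<bar>int i - int j\<bar> \<ge> 2"
  shows "Transposition.transpose i (Suc i) \<circ> Transposition.transpose j (Suc j) =
         Transposition.transpose j (Suc j) \<circ> Transposition.transpose i (Suc i)"
proof -
  have "i \<noteq> j" "i \<noteq> Suc j" "Suc i \<noteq> j" using assms by auto
  then show ?thesis by (auto simp: fun_eq_iff Transposition.transpose_def)
qed

lemma transpose_braid:
  fixes i :: nat
  shows "Transposition.transpose i (Suc i) \<circ>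
           (Transposition.transpose (Suc i) (Suc (Suc i)) \<circ> Transposition.transpose i (Suc i)) =
         Transposition.transpose (Suc i) (Suc (Suc i)) \<circ>
           (Transposition.transpose i (Suc i) \<circ> Transposition.transpose (Suc i) (Suc (Suc i)))"
  by (auto simp: fun_eq_iff Transposition.transpose_def)

lemma word_perm_cong:
  "word_cong (braid_gens n) (braid_rels n) u v \<Longrightarrow> word_perm u = word_perm v"
proof (induction rule: word_cong.induct)
  case (rel u v)
  then show ?case
    unfolding braid_rels_def
    apply (elim UnE)
    subgoal by (auto simp: word_perm_def transpose_commute)
    subgoal by (auto simp: word_perm_def transpose_braid)
    subgoal by (auto simp: word_perm_def)
    subgoal by (auto simp: word_perm_def)
    subgoal by (auto simp: word_perm_def)
    subgoal by (auto simp del: map_append simp: word_perm_map_sg_rev) (simp add: word_perm_def)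
    done
next
  case (cancel g e)
  then show ?case by (cases g) (auto simp: word_perm_def)
qed (auto simp: word_perm_append)

lemma braid_perm_braid_of:
  assumes "w \<in> words_over (braid_gens n)"
  shows "braid_perm (braid_of n w) = word_perm w"
proof -
  have "braid_of n w \<noteq> {}"
    using assms by (auto simp: braid_of_def word_class_def intro: word_cong.refl)
  moreover have "word_perm v = word_perm w" if "v \<in> braid_of n w" for v
    using that word_perm_cong[of n w v] by (simp add: braid_of_def word_class_def)
  ultimately show ?thesis
    unfolding braid_perm_def by (rule the_elem_image_unique)
qed

lemma word_perm_permutes:
  "w \<in> words_over (braid_gens n) \<Longrightarrow> word_perm w permutes {1..n}"
proof (induction w)
  case Nil
  show ?case
    using permutes_id[of "{1..n}"] by (simp add: word_perm_def id_def)
next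
  case (Cons x w)
  then have w: "word_perm w permutes {1..n}" and x: "fst x \<in> braid_gens n"
    by (auto simp: words_over_def)
  have "letter_perm x permutes {1..n}"
    using x by (cases x) (auto simp: braid_gens_def intro!: permutes_swap_id permutes_id)
  moreover have "word_perm (x # w) = letter_perm x \<circ> word_perm w"
    by (simp add: word_perm_def)
  ultimately show ?case
    using w by (simp only: permutes_compose)
qed

lemma braid_perm_hom: "braid_perm \<in> hom (RP2_braid_group n) (sym_group n)"
proof (rule homI)
  have ap: "u @ v \<in> words_over (braid_gens n)"
    if "u \<in> words_over (braid_gens n)" "v \<in> words_over (braid_gens n)" for u v
    using that by (simp add: words_over_def)
  have c: "carrier (RP2_braid_group n) = braid_of n ` words_over (braid_gens n)"
    by (simp add: RP2_braid_group_def braid_of_def presented_group_def)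
  show "braid_perm x \<in> carrier (sym_group n)" if "x \<in> carrier (RP2_braid_group n)" for x
    using that word_perm_permutes[of _ n] by (auto simp: c braid_perm_braid_of sym_group_def)
  show "braid_perm (x \<otimes>\<^bsub>RP2_braid_group n\<^esub> y) = braid_perm x \<otimes>\<^bsub>sym_group n\<^esub> braid_perm y"
    if xy: "x \<in> carrier (RP2_braid_group n)" "y \<in> carrier (RP2_braid_group n)" for x y
  proof -
    obtain u v where uv: "u \<in> words_over (braid_gens n)" "v \<in> words_over (braid_gens n)"
      "x = braid_of n u" "y = braid_of n v"
      using xy by (auto simp: c)
    then have "x \<otimes>\<^bsub>RP2_braid_group n\<^esub> y = braid_of n (u @ v)"
      by (simp add: RP2_braid_group_def braid_of_def presented_group_mult)
    then show ?thesis
      using uv by (simp add: braid_perm_braid_of ap word_perm_append sym_group_def)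
  qed
qed


section \<open>Mapping class groups of the projective plane\<close>

text \<open>A point of the projective plane is a pair of antipodal points of the unit sphere. The
  topology is the quotient topology.\<close>

definition RP2 :: "(real ^ 3) set topology" where
  "RP2 = topology (\<lambda>U. U \<subseteq> (\<lambda>x. {x, - x}) ` sphere 0 1 \<and>
           openin (top_of_set (sphere 0 1)) {x \<in> sphere 0 1. {x, - x} \<in> U})"

lemma openin_RP2:
  "openin RP2 U \<longleftrightarrow> U \<subseteq> (\<lambda>x. {x, - x}) ` sphere 0 1 \<and>
     openin (top_of_set (sphere 0 1)) {x \<in> sphere 0 1. {x, - x} \<in> U}"
proof -
  let ?S = "sphere 0 1 :: (real ^ 3) set"
  let ?P = "\<lambda>U. U \<subseteq> (\<lambda>x. {x, - x}) ` ?S \<and>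
             openin (top_of_set ?S) {x \<in> ?S. {x, - x} \<in> U}"
  have "istopology ?P"
    unfolding istopology_def
  proof (intro conjI allI impI)
    fix U V
    assume UV: "?P U" "?P V"
    then show "U \<inter> V \<subseteq> (\<lambda>x. {x, - x}) ` ?S"
      by blast
    have "{x \<in> ?S. {x, - x} \<in> U \<inter> V} = {x \<in> ?S. {x, - x} \<in> U} \<inter> {x \<in> ?S. {x, - x} \<in> V}"
      by blast
    then show "openin (top_of_set ?S) {x \<in> ?S. {x, - x} \<in> U \<inter> V}"
      using UV by (simp only: openin_Int)
  next
    fix \<U>
    assume \<U>: "\<forall>U\<in>\<U>. ?P U"
    then show "\<Union>\<U> \<subseteq> (\<lambda>x. {x, - x}) ` ?S"
      by (intro Union_least) blast
    have "{x \<in> ?S. {x, - x} \<in> \<Union>\<U>} = \<Union> ((\<lambda>U. {x \<in> ?S. {x, - x} \<in> U}) ` \<U>)"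
      by blast
    moreover have "openin (top_of_set ?S) (\<Union> ((\<lambda>U. {x \<in> ?S. {x, - x} \<in> U}) ` \<U>))"
      by (rule openin_Union) (use \<U> in blast)
    ultimately show "openin (top_of_set ?S) {x \<in> ?S. {x, - x} \<in> \<Union>\<U>}"
      by (simp only:)
  qed
  then show ?thesis
    unfolding RP2_def by simp
qed

lemma topspace_RP2: "topspace RP2 = (\<lambda>x. {x, - x}) ` sphere 0 1"
proof
  show "topspace RP2 \<subseteq> (\<lambda>x. {x, - x}) ` sphere 0 1"
    using openin_RP2[of "topspace RP2"] by simp
  have "{x \<in> sphere 0 1. {x, - x} \<in> (\<lambda>x. {x, - x}) ` sphere 0 1} = (sphere 0 1 :: (real ^ 3) set)"
    by blast
  then have "openin RP2 ((\<lambda>x. {x, - x}) ` sphere 0 1)"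
    by (simp only: openin_RP2 openin_subtopology_self) simp
  then show "(\<lambda>x. {x, - x}) ` sphere 0 1 \<subseteq> topspace RP2"
    by (rule openin_subset)
qed

text \<open>Homeomorphisms are extensional functions, so that distinct elements differ on the
  projective plane.\<close>

definition RP2_homeos :: "(real ^ 3) set set \<Rightarrow> ((real ^ 3) set \<Rightarrow> (real ^ 3) set) set" where
  "RP2_homeos X = {f \<in> extensional (topspace RP2). homeomorphic_map RP2 RP2 f \<and> f ` X = X}"

definition RP2_pure_homeos :: "(real ^ 3) set set \<Rightarrow> ((real ^ 3) set \<Rightarrow> (real ^ 3) set) set" where
  "RP2_pure_homeos X = {f \<in> RP2_homeos X. \<forall>x\<in>X. f x = x}"

definition RP2_isotopic ::
  "(real ^ 3) set set \<Rightarrow> ((real ^ 3) set \<Rightarrow> (real ^ 3) set) \<Rightarrow> ((real ^ 3) set \<Rightarrow> (real ^ 3) set) \<Rightarrow> bool"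
where
  "RP2_isotopic X f g \<longleftrightarrow> (\<exists>H.
     continuous_map (prod_topology (top_of_set {0..1::real}) RP2) RP2 (\<lambda>(t, x). H t x) \<and>
     (\<forall>t\<in>{0..1}. homeomorphic_map RP2 RP2 (H t)) \<and>
     (\<forall>t\<in>{0..1}. \<forall>x\<in>X. H t x = H 0 x) \<and>
     (\<forall>x\<in>topspace RP2. H 0 x = f x \<and> H 1 x = g x))"

definition isotopy_class ::
  "(real ^ 3) set set \<Rightarrow> ((real ^ 3) set \<Rightarrow> (real ^ 3) set) \<Rightarrow> ((real ^ 3) set \<Rightarrow> (real ^ 3) set) set"
where
  "isotopy_class X f = {g \<in> RP2_homeos X. RP2_isotopic X f g}"

definition MCG :: "(real ^ 3) set set \<Rightarrow> ((real ^ 3) set \<Rightarrow> (real ^ 3) set) set monoid" where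
  "MCG X = \<lparr>carrier = isotopy_class X ` RP2_homeos X,
            mult = \<lambda>A B. \<Union>f\<in>A. \<Union>g\<in>B. isotopy_class X (compose (topspace RP2) f g),
            one = isotopy_class X (\<lambda>x\<in>topspace RP2. x)\<rparr>"

definition PMCG :: "(real ^ 3) set set \<Rightarrow> ((real ^ 3) set \<Rightarrow> (real ^ 3) set) set monoid" where
  "PMCG X = (MCG X)\<lparr>carrier := isotopy_class X ` RP2_pure_homeos X\<rparr>"

text \<open>An identification of the mapping class group of the projective plane relative to \<open>X\<close> with
  the quotient of the braid group by the full twist, under which the pure subgroups correspond.\<close>

definition MCG_identification ::
  "nat \<Rightarrow> (real ^ 3) set set \<Rightarrow>
   (braid_gen word set set \<Rightarrow> ((real ^ 3) set \<Rightarrow> (real ^ 3) set) set) \<Rightarrow> bool"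
where
  "MCG_identification n X \<phi> \<longleftrightarrow>
     \<phi> \<in> iso (braid_MCG n) (MCG X) \<and> \<phi> ` carrier (braid_PMCG n) = carrier (PMCG X)"

end

theory Submission
  imports Defs
begin

text \<open>
Write \<open>g = \<sigma>\<^sub>1 \<dots> \<sigma>\<^sub>n\<^sub>-\<^sub>1\<close>, so that the full twist is \<open>g\<^sup>n\<close>. Everything rests on the way in which \<open>a\<close>
acts by conjugation. It shifts the generators, \<open>\<sigma>\<^sub>i \<mapsto> \<sigma>\<^sub>i\<^sub>-\<^sub>1\<close> and \<open>\<rho>\<^sub>j \<mapsto> \<rho>\<^sub>j\<^sub>-\<^sub>1\<close>, and closes up with a
twist: \<open>\<rho>\<^sub>1 \<mapsto> \<rho>\<^sub>n\<inverse>\<close>, and \<open>a\<^sup>2\<close> takes \<open>\<sigma>\<^sub>1\<close> to \<open>\<sigma>\<^sub>n\<^sub>-\<^sub>1\<inverse>\<close>. So \<open>a\<^sup>n\<close> inverts all generators, and \<open>a\<^sup>2\<^sup>n\<close> is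
central. The identities \<open>a\<^sup>n = \<rho>\<^sub>n b\<^sup>n\<^sup>-\<^sup>1 = \<rho>\<^sub>n \<dots> \<rho>\<^sub>1\<close> and \<open>g a = \<rho>\<^sub>1\<close> then give
\<open>a\<^sup>2\<^sup>n = b\<^sup>2\<^sup>(\<^sup>n\<^sup>-\<^sup>1\<^sup>)\<close> and \<open>g\<^sup>n = a\<^sup>-\<^sup>2\<^sup>n\<close> (lemmas \<open>rot_pow_Suc\<close>, \<open>rot_pred_pow_square\<close>, \<open>asc_pow_eq\<close>).
Hence the full twist is central, and the images of \<open>a\<^sup>n\<close>, of \<open>b\<^sup>n\<^sup>-\<^sup>1\<close> and of its conjugates have square one
in the quotient.

As for generation, conjugating \<open>a\<^sup>n = \<rho>\<^sub>n b\<^sup>n\<^sup>-\<^sup>1\<close> by \<open>a\<^sup>k\<close> shows that the given elements generate the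
same subgroup as \<open>\<rho>\<^sub>1, \<dots>, \<rho>\<^sub>n\<close> (\<open>generate_rot_powers\<close>). That subgroup is normal and contains all
\<open>\<sigma>\<^sub>i\<^sup>2\<close>, since these are commutators of elements \<open>\<rho>\<close>. The quotient by it satisfies the Coxeter
relations of the symmetric group, so it acts faithfully by permutations, and the subgroup is
the whole pure braid group (\<open>pure_subgroup_generated\<close>).

As for the lower bound, counting the letters \<open>\<rho>\<close> on each strand modulo two is a homomorphism from the pure braid
group onto \<open>(\<int>/2)\<^sup>n\<close> that kills the full twist (\<open>braid_flips_hom\<close>, \<open>braid_flips_onto\<close>). A normally
generating set is mapped to a generating set of \<open>(\<int>/2)\<^sup>n\<close>, so it has at least \<open>n\<close> elements. By the same
bound none of the \<open>n\<close> generators is trivial, and so all of them have order two.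

For homeomorphisms of the projective plane with marked points the statement is transported along the
given identification. The only point to check is that it respects neutral elements, which holds because
isotopy is an equivalence relation (\<open>iso_one_MCG\<close>).
\<close>

section \<open>Elementary abelian quotients bound the number of normal generators\<close>

definition symdiff_group :: "'a set \<Rightarrow> 'a set monoid" where
  "symdiff_group A = \<lparr>carrier = Pow A, mult = sym_diff, one = {}\<rparr>"

lemma comm_group_symdiff_group: "comm_group (symdiff_group A)"
  by (rule comm_groupI) (auto simp: symdiff_group_def)

text \<open>Adjoining an involution \<open>y\<close> to a subgroup \<open>Z\<close> of an abelian group yields \<open>Z \<union> y Z\<close>, so each new
generator at most doubles the size.\<close>

lemma (in comm_group) card_generate_involutions:
  assumes "finite Y" "Y \<subseteq> carrier G" "\<And>y. y \<in> Y \<Longrightarrow> y \<otimes> y = \<one>"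
  shows "finite (generate G Y) \<and> card (generate G Y) \<le> 2 ^ card Y"
  using assms
proof (induction Y)
  case empty
  then show ?case by (simp add: generate_empty)
next
  case (insert y Y)
  let ?Z = "generate G Y"
  have Z: "subgroup ?Z G" and y: "y \<in> carrier G" and yy: "y \<otimes> y = \<one>"
    using insert.prems by (simp_all add: generate_is_subgroup)
  interpret Z: subgroup ?Z G by (rule Z)
  have iy: "inv y = y" using y yy by (simp add: inv_equality)
  have "subgroup (?Z \<union> (\<otimes>) y ` ?Z) G"
  proof (rule subgroupI)
    show "?Z \<union> (\<otimes>) y ` ?Z \<subseteq> carrier G" using y Z.subset by auto
    show "?Z \<union> (\<otimes>) y ` ?Z \<noteq> {}" using Z.one_closed by blast
  next
    fix a assume "a \<in> ?Z \<union> (\<otimes>) y ` ?Z"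
    then show "inv a \<in> ?Z \<union> (\<otimes>) y ` ?Z"
      using Z.mem_carrier y by (auto simp: inv_mult iy)
  next
    fix a b assume ab: "a \<in> ?Z \<union> (\<otimes>) y ` ?Z" "b \<in> ?Z \<union> (\<otimes>) y ` ?Z"
    have 1: "u \<otimes> (y \<otimes> v) = y \<otimes> (u \<otimes> v)" if "u \<in> ?Z" "v \<in> ?Z" for u v
      using that y Z.mem_carrier by (simp add: m_lcomm)
    have 2: "y \<otimes> u \<otimes> (y \<otimes> v) = u \<otimes> v" if "u \<in> ?Z" "v \<in> ?Z" for u v
    proof -
      have "y \<otimes> u \<otimes> (y \<otimes> v) = (y \<otimes> y) \<otimes> (u \<otimes> v)"
        using that y Z.mem_carrier by (simp add: m_ac)
      then show ?thesis using that yy Z.mem_carrier by simp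
    qed
    show "a \<otimes> b \<in> ?Z \<union> (\<otimes>) y ` ?Z"
      using ab
    proof (elim UnE imageE)
      fix v assume "a \<in> ?Z" "b = y \<otimes> v" "v \<in> ?Z"
      then show ?thesis using 1[of a v] by auto
    next
      fix u assume "a = y \<otimes> u" "u \<in> ?Z" "b \<in> ?Z"
      then show ?thesis using y Z.mem_carrier by (auto simp: m_assoc)
    qed (use 2 in auto)
  qed
  moreover have "insert y Y \<subseteq> ?Z \<union> (\<otimes>) y ` ?Z"
    using Z.one_closed y by (auto intro: generate.incl image_eqI[of _ _ \<one>])
  ultimately have sub: "generate G (insert y Y) \<subseteq> ?Z \<union> (\<otimes>) y ` ?Z"
    by (rule generate_subgroup_incl[rotated])
  have fin: "finite ?Z" and le: "card ?Z \<le> 2 ^ card Y"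
    using insert by auto
  have "card (generate G (insert y Y)) \<le> card (?Z \<union> (\<otimes>) y ` ?Z)"
    using sub fin by (intro card_mono) auto
  also have "\<dots> \<le> card ?Z + card ?Z"
    using card_Un_le card_image_le[OF fin] by (meson add_left_mono le_trans)
  also have "\<dots> \<le> 2 ^ card (insert y Y)"
    using le insert.hyps by simp
  finally show ?case using sub fin by (auto intro: finite_subset)
qed

text \<open>In an abelian image of \<open>G\<close> every subgroup is normal, so the image of a normally generating set
generates. An elementary abelian \<open>2\<close>-group of order \<open>2 ^ card A\<close> needs \<open>card A\<close> generators by
the previous lemma.\<close>

lemma card_le_normally_generating_set:
  assumes "group G" "finite A" and h: "h \<in> hom G (symdiff_group A)"
    and onto: "h ` carrier G = Pow A" and Y: "finite Y" "normally_generated_by G Y"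
  shows "card A \<le> card Y"
proof -
  let ?E = "symdiff_group A"
  interpret E: comm_group ?E by (rule comm_group_symdiff_group)
  interpret h: group_hom G ?E h
    using assms(1) h E.is_group by (simp add: group_hom_def group_hom_axioms_def)
  have YG: "Y \<subseteq> carrier G" and cl: "normal_closure G Y = carrier G"
    using Y(2) by (auto simp: normally_generated_by_def)
  then have hY: "h ` Y \<subseteq> carrier ?E" using h.hom_closed by auto
  let ?Z = "generate ?E (h ` Y)"
  have Z: "subgroup ?Z ?E" by (rule E.generate_is_subgroup[OF hY])
  let ?N = "{x \<in> carrier G. h x \<in> ?Z}"
  have "?N \<lhd> G"
  proof (rule h.G.normal_invI)
    show "subgroup ?N G"
      using subgroup.one_closed[OF Z] subgroup.m_closed[OF Z] subgroup.m_inv_closed[OF Z]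
      by (intro h.G.subgroupI) auto
  next
    fix x g assume g: "x \<in> carrier G" and x: "g \<in> ?N"
    then have "h (x \<otimes>\<^bsub>G\<^esub> g \<otimes>\<^bsub>G\<^esub> inv\<^bsub>G\<^esub> x) = h g"
      by (simp add: E.m_comm[of "h x" "h g"] E.m_assoc del: h.hom_inv) (simp flip: h.hom_mult)
    then show "x \<otimes>\<^bsub>G\<^esub> g \<otimes>\<^bsub>G\<^esub> inv\<^bsub>G\<^esub> x \<in> ?N"
      using g x by simp
  qed
  moreover have "Y \<subseteq> ?N" using YG by (auto intro: generate.incl)
  ultimately have "carrier G \<subseteq> ?N" using cl by (auto simp: normal_closure_def)
  then have "h ` carrier G \<subseteq> ?Z" by auto
  then have "Pow A \<subseteq> ?Z" by (simp only: onto)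
  moreover have "finite ?Z \<and> card ?Z \<le> 2 ^ card (h ` Y)"
    using hY Y(1) by (intro E.card_generate_involutions) (auto simp: symdiff_group_def)
  ultimately have "card (Pow A) \<le> 2 ^ card (h ` Y)"
    using card_mono order_trans by blast
  also have "\<dots> \<le> 2 ^ card Y"
    using card_image_le[OF Y(1)] by (intro power_increasing) auto
  finally show ?thesis using assms(2) by (simp add: card_Pow)
qed

lemma (in group) generated_imp_normally_generated:
  assumes "generated_by G Y"
  shows "normally_generated_by G Y"
proof -
  have "carrier G \<subseteq> N" if "N \<lhd> G" "Y \<subseteq> N" for N
    using assms generate_subgroup_incl[OF that(2)] normal_imp_subgroup[OF that(1)]
    by (simp add: generated_by_def)
  moreover have "normal_closure G Y \<subseteq> carrier G"
    using assms normal_self by (auto simp: normal_closure_def generated_by_def)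
  ultimately show ?thesis
    using assms by (auto simp: normally_generated_by_def generated_by_def normal_closure_def)
qed

lemma min_card_eqI:
  assumes "Q T" "finite T" "card T \<le> n" "\<And>Y. finite Y \<Longrightarrow> Q Y \<Longrightarrow> n \<le> card Y"
  shows "min_card Q = enat n"
  unfolding min_card_def
proof (rule antisym)
  show "(INF X\<in>{X. Q X}. if finite X then enat (card X) else \<infinity>) \<le> enat n"
    using assms by (intro INF_lower2[of T]) auto
  show "enat n \<le> (INF X\<in>{X. Q X}. if finite X then enat (card X) else \<infinity>)"
    using assms by (intro INF_greatest) auto
qed

text \<open>All claims about ranks and orders follow from two facts: \<open>n\<close> elements of square one generate, and
there is a homomorphism onto an elementary abelian \<open>2\<close>-group of rank \<open>n\<close>. That none of the
generators is trivial needs no computation, because a trivial one could be left out and the lower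
bound on generating sets would be violated.\<close>

lemma rank_eq_of_involutions:
  assumes "group G" and T: "finite T" "card T \<le> n" "generated_by G T"
    and sq: "\<And>t. t \<in> T \<Longrightarrow> t \<otimes>\<^bsub>G\<^esub> t = \<one>\<^bsub>G\<^esub>"
    and h: "h \<in> hom G (symdiff_group {1..n::nat})" "h ` carrier G = Pow {1..n}"
  shows "torsion_generated_by G T \<and> (\<forall>t\<in>T. group.ord G t = 2) \<and>
    G_rank G = enat n \<and> NG_rank G = enat n \<and> TG_rank G = enat n \<and> NTG_rank G = enat n \<and>
    (\<forall>Y. finite Y \<and> card Y < n \<longrightarrow> \<not> normally_generated_by G Y)"
proof -
  interpret group G by (rule assms(1))
  have lower: "n \<le> card Y" if "finite Y" "normally_generated_by G Y" for Y
    using card_le_normally_generating_set[OF assms(1) _ h that] by simp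
  have TG: "T \<subseteq> carrier G" using T(3) by (simp add: generated_by_def)
  have sq2: "t [^]\<^bsub>G\<^esub> (2::nat) = \<one>\<^bsub>G\<^esub>" if "t \<in> T" for t
    using sq[OF that] TG that by (auto simp: numeral_2_eq_2)
  then have fin: "finite_order G t" if "t \<in> T" for t
    using that by (auto simp: finite_order_def intro: exI[of _ 2])
  have ne: "t \<noteq> \<one>\<^bsub>G\<^esub>" if "t \<in> T" for t
  proof
    assume t: "t = \<one>\<^bsub>G\<^esub>"
    have "subgroup (generate G (T - {t})) G" using TG by (intro generate_is_subgroup) auto
    moreover have "T \<subseteq> generate G (T - {t})"
      using generate.one[of G] generate.incl[of _ "T - {t}" G] t by auto
    ultimately have "generate G T \<subseteq> generate G (T - {t})"
      by (rule generate_subgroup_incl[rotated])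
    then have "generated_by G (T - {t})"
      using T(3) generate_incl[of "T - {t}"] by (auto simp: generated_by_def)
    then have "n \<le> card (T - {t})"
      using lower T(1) generated_imp_normally_generated by simp
    moreover have "card (T - {t}) < card T"
      using T(1) that by (intro psubset_card_mono) auto
    ultimately show False using T(2) by simp
  qed
  have "ord t = 2" if "t \<in> T" for t
  proof -
    have "t \<in> carrier G" using that TG by auto
    then have "ord t dvd 2" "ord t \<noteq> 1"
      using sq2[OF that] ne[OF that] pow_eq_id[of t 2] ord_eq_1[of t] by simp_all
    then show ?thesis
      by (meson primes_dvd_imp_eq prime_nat_iff two_is_prime_nat)
  qed
  moreover have tor: "torsion_generated_by G T" using T(3) fin by (simp add: torsion_generated_by_def)
  have rank: "min_card Q = enat n"
    if "Q T" "\<And>Y. Q Y \<Longrightarrow> normally_generated_by G Y" for Q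
    using that T lower by (intro min_card_eqI[of Q T]) auto
  have "G_rank G = enat n"
    using rank[of "generated_by G", OF T(3) generated_imp_normally_generated]
    by (simp add: G_rank_def)
  moreover have "NG_rank G = enat n"
    using rank[of "normally_generated_by G", OF generated_imp_normally_generated[OF T(3)]]
    by (simp add: NG_rank_def)
  moreover have "TG_rank G = enat n"
    using rank[of "torsion_generated_by G", OF tor]
    by (simp add: TG_rank_def torsion_generated_by_def generated_imp_normally_generated)
  moreover have "normally_torsion_generated_by G T"
    using T(3) fin by (simp add: normally_torsion_generated_by_def generated_imp_normally_generated)
  then have "NTG_rank G = enat n"
    using rank[of "normally_torsion_generated_by G"]
    by (simp add: NTG_rank_def normally_torsion_generated_by_def)
  ultimately show ?thesis using lower tor by (meson not_le)
qed

text \<open>The condition on \<open>h\<close> in \<open>FactGroup_universal\<close> speaks of pairs of equal cosets; in applications one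
knows that \<open>h\<close> is trivial on \<open>K\<close>.\<close>

lemma hom_FactGroup_factor:
  assumes "h \<in> hom G H" "group H" "K \<lhd> G" "\<And>k. k \<in> K \<Longrightarrow> h k = \<one>\<^bsub>H\<^esub>"
  obtains g where "g \<in> hom (G Mod K) H" "\<And>x. x \<in> carrier G \<Longrightarrow> g (K #>\<^bsub>G\<^esub> x) = h x"
proof -
  interpret K: normal K G by (rule assms(3))
  interpret h: group_hom G H h
    using assms K.is_group by (simp add: group_hom_def group_hom_axioms_def)
  have "h x = h y" if "x \<in> carrier G" "y \<in> carrier G" "K #>\<^bsub>G\<^esub> x = K #>\<^bsub>G\<^esub> y" for x y
  proof -
    have "x \<in> K #>\<^bsub>G\<^esub> y" using that K.rcos_self[of x] K.subgroup_axioms by metis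
    then obtain k where "k \<in> K" "x = k \<otimes>\<^bsub>G\<^esub> y" by (auto simp: r_coset_def)
    then show ?thesis using that assms(4) K.mem_carrier by simp
  qed
  then show thesis using FactGroup_universal[OF assms(1,3)] that by blast
qed

section \<open>Artin's and Coxeter's relations\<close>

locale artin_relations = group G for G (structure) +
  fixes s :: "nat \<Rightarrow> 'a" and n :: nat
  assumes s_closed [simp]: "s i \<in> carrier G"
    and far_commute: "\<lbrakk>1 \<le> i; i + 2 \<le> j; j < n\<rbrakk> \<Longrightarrow> s i \<otimes> s j = s j \<otimes> s i"
    and braid: "\<lbrakk>1 \<le> i; i + 1 < n\<rbrakk> \<Longrightarrow>
      s i \<otimes> (s (i + 1) \<otimes> s i) = s (i + 1) \<otimes> (s i \<otimes> s (i + 1))"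
begin

text \<open>\<open>desc k m = s m \<otimes> s (m - 1) \<otimes> \<dots> \<otimes> s k\<close> for \<open>k \<ge> 1\<close>, which is \<open>\<one>\<close> when \<open>m < k\<close>.\<close>

primrec desc :: "nat \<Rightarrow> nat \<Rightarrow> 'a" where
  "desc k 0 = \<one>"
| "desc k (Suc m) = (if k \<le> Suc m then s (Suc m) \<otimes> desc k m else \<one>)"

primrec asc :: "nat \<Rightarrow> 'a" where
  "asc 0 = \<one>"
| "asc (Suc m) = asc m \<otimes> s (Suc m)"

lemma desc_closed [simp]: "desc k m \<in> carrier G"
  by (induction m) auto

lemma asc_closed [simp]: "asc m \<in> carrier G"
  by (induction m) auto

lemma desc_empty: "m < k \<Longrightarrow> desc k m = \<one>"
  by (cases m) auto

lemma desc_drop: "\<lbrakk>1 \<le> k; k \<le> m\<rbrakk> \<Longrightarrow> desc k m = desc (Suc k) m \<otimes> s k"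
proof (induction m)
  case (Suc m)
  then show ?case
    by (cases "k = Suc m") (auto simp: desc_empty m_assoc)
qed simp

lemma far_commute': "\<lbrakk>1 \<le> i; i + 2 \<le> j; j < n; x \<in> carrier G\<rbrakk> \<Longrightarrow>
    s j \<otimes> (s i \<otimes> x) = s i \<otimes> (s j \<otimes> x)"
  using far_commute[of i j] by (simp flip: m_assoc)

lemma desc_commute_above: "\<lbrakk>1 \<le> k; m + 2 \<le> j; j < n\<rbrakk> \<Longrightarrow> desc k m \<otimes> s j = s j \<otimes> desc k m"
proof (induction m)
  case (Suc m)
  then show ?case
    using far_commute'[of "Suc m" j "desc k m"] by (simp add: m_assoc)
qed simp

lemma desc_commute_below: "\<lbrakk>1 \<le> j; j + 2 \<le> k; m < n\<rbrakk> \<Longrightarrow> desc k m \<otimes> s j = s j \<otimes> desc k m"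
proof (induction m)
  case (Suc m)
  then show ?case
    using far_commute'[of j "Suc m" "desc k m"] by (cases "k \<le> Suc m") (auto simp: m_assoc)
qed simp

text \<open>Conjugation by a descending product shifts the generators down by one: \<open>s i\<close> moves left past the
factors below \<open>s (i - 1)\<close>, and \<open>s i s (i - 1) s i = s (i - 1) s i s (i - 1)\<close> turns it into \<open>s (i - 1)\<close>,
which commutes with the remaining factors.\<close>

lemma desc_shift: "\<lbrakk>1 \<le> k; k < i; i \<le> m; m < n\<rbrakk> \<Longrightarrow> desc k m \<otimes> s i = s (i - 1) \<otimes> desc k m"
proof (induction m)
  case (Suc m)
  show ?case
  proof (cases "i = Suc m")
    case True
    then obtain l where m: "m = Suc l" using Suc.prems by (cases m) auto
    have "desc k l \<otimes> s i = s i \<otimes> desc k l"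
      using Suc.prems True m by (intro desc_commute_above) auto
    then have "desc k (Suc m) \<otimes> s i = (s (Suc m) \<otimes> (s m \<otimes> s (Suc m))) \<otimes> desc k l"
      using Suc.prems True m by (simp add: m_assoc)
    also have "s (Suc m) \<otimes> (s m \<otimes> s (Suc m)) = s m \<otimes> (s (Suc m) \<otimes> s m)"
      using braid[of m] Suc.prems m by simp
    finally show ?thesis
      using Suc.prems True m by (simp add: m_assoc)
  next
    case False
    then have "desc k (Suc m) \<otimes> s i = s (Suc m) \<otimes> (s (i - 1) \<otimes> desc k m)"
      using Suc by (simp add: m_assoc)
    also have "\<dots> = s (i - 1) \<otimes> (s (Suc m) \<otimes> desc k m)"
      using Suc.prems False by (intro far_commute') auto
    finally show ?thesis using Suc.prems by simp
  qed
qed simp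

end

locale coxeter_relations = artin_relations +
  assumes involution: "\<lbrakk>1 \<le> i; i < n\<rbrakk> \<Longrightarrow> s i \<otimes> s i = \<one>"
begin

text \<open>The normal form behind the bound \<open>m + 1\<close> on the index of the parabolic subgroup generated by
\<open>s 1, \<dots>, s (m - 1)\<close> in the one generated by \<open>s 1, \<dots>, s m\<close>: the products \<open>desc k m\<close> represent all
cosets, since multiplying \<open>desc k m\<close> on the right by \<open>s j\<close> either changes \<open>k\<close> by one or moves a
generator of index below \<open>m\<close> to the left.\<close>

lemma generate_decompose:
  assumes "m < n" "x \<in> generate G (s ` {1..m})"
  shows "\<exists>u\<in>generate G (s ` {1..m - 1}). \<exists>k\<in>{1..m + 1}. x = u \<otimes> desc k m"
proof -
  let ?U = "generate G (s ` {1..m - 1})"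
  define V where "V = {u \<otimes> desc k m | u k. u \<in> ?U \<and> k \<in> {1..m + 1}}"
  have sub: "s ` {1..m - 1} \<subseteq> carrier G" by auto
  note Uc = generate_in_carrier[OF sub]
  have VI: "u \<otimes> desc k m \<in> V" if "u \<in> ?U" "1 \<le> k" "k \<le> m + 1" for u k
    using that by (auto simp: V_def)
  have step: "v \<otimes> s j \<in> V" if v: "v \<in> V" and j: "1 \<le> j" "j \<le> m" for v j
  proof -
    obtain u k where uk: "u \<in> ?U" "1 \<le> k" "k \<le> m + 1" "v = u \<otimes> desc k m"
      using v by (auto simp: V_def)
    have u: "u \<in> carrier G" using uk Uc by simp
    have us: "u \<otimes> s i \<in> ?U" if "1 \<le> i" "i \<le> m - 1" for i
      using that by (intro generate.eng[OF uk(1) generate.incl]) auto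
    consider "j + 2 \<le> k" | "k = Suc j" | "j = k" | "k < j" by linarith
    then show ?thesis
    proof cases
      case 1
      then have "v \<otimes> s j = (u \<otimes> s j) \<otimes> desc k m"
        using u j assms uk by (simp add: m_assoc desc_commute_below)
      then show ?thesis using us[of j] 1 j uk VI by simp
    next
      case 2
      then have "v \<otimes> s j = u \<otimes> desc j m"
        using u j uk by (simp add: m_assoc desc_drop)
      then show ?thesis using j uk VI by simp
    next
      case 3
      then have "v \<otimes> s j = u \<otimes> (desc (Suc j) m \<otimes> (s j \<otimes> s j))"
        using u j uk by (simp add: m_assoc desc_drop)
      also have "\<dots> = u \<otimes> desc (Suc j) m"
        using involution[of j] j assms by simp
      finally show ?thesis using j uk VI by simp
    next
      case 4
      then have "v \<otimes> s j = (u \<otimes> s (j - 1)) \<otimes> desc k m"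
        using u j uk assms by (simp add: m_assoc desc_shift)
      then show ?thesis using us[of "j - 1"] 4 j uk VI by simp
    qed
  qed
  have Vc: "v \<in> carrier G" if "v \<in> V" for v
    using that Uc by (auto simp: V_def)
  have "v \<otimes> x \<in> V" if "v \<in> V" for v
    using assms(2) that
  proof (induction arbitrary: v rule: generate.induct)
    case one
    then show ?case using Vc by simp
  next
    case (incl h)
    then show ?case using step by auto
  next
    case (inv h)
    then obtain i where i: "1 \<le> i" "i \<le> m" "h = s i" by auto
    then have "inv h = s i" using involution[of i] assms by (simp add: inv_equality)
    then show ?case using step inv i by auto
  next
    case (eng h1 h2)
    have "s ` {1..m} \<subseteq> carrier G" by auto
    then have "h1 \<in> carrier G" "h2 \<in> carrier G" "v \<in> carrier G"
      using eng Vc generate_in_carrier by blast+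
    then show ?case using eng by (simp flip: m_assoc)
  qed
  from this[OF VI[OF generate.one, of "m + 1"]] have "\<one> \<otimes> desc (m + 1) m \<otimes> x \<in> V" by simp
  moreover have "s ` {1..m} \<subseteq> carrier G" by auto
  then have "x \<in> carrier G" using generate_in_carrier assms by blast
  ultimately have "x \<in> V" by (simp add: desc_empty)
  then show ?thesis unfolding V_def by fastforce
qed

text \<open>A group generated by elements with the Coxeter relations of the symmetric group maps faithfully to
permutations. In the normal form \<open>u desc k m\<close> the permutation of \<open>u\<close> fixes \<open>m + 1\<close> while that of
\<open>desc k m\<close> sends \<open>k\<close> to \<open>m + 1\<close>, so for a trivial permutation \<open>k = m + 1\<close>, the second factor
is empty, and one descends to \<open>m - 1\<close>.\<close>

theorem faithful_permutation_action:
  assumes \<pi>: "\<pi> \<in> hom G (sym_group n)"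
    and \<pi>_s: "\<And>i. \<lbrakk>1 \<le> i; i < n\<rbrakk> \<Longrightarrow> \<pi> (s i) = Transposition.transpose i (i + 1)"
    and "m < n" "x \<in> generate G (s ` {1..m})" "\<pi> x = id"
  shows "x = \<one>"
  using assms(3-)
proof (induction m arbitrary: x)
  case 0
  then show ?case by (simp add: generate_empty)
next
  case (Suc m)
  interpret \<pi>: group_hom G "sym_group n" \<pi>
    using \<pi> sym_group_is_group by (simp add: group_hom_def group_hom_axioms_def)
  obtain u k where u: "u \<in> generate G (s ` {1..m})" and k: "1 \<le> k" "k \<le> Suc m + 1"
    and x: "x = u \<otimes> desc k (Suc m)"
    using generate_decompose[OF Suc.prems(1,2)] by auto
  have sub: "s ` {1..m} \<subseteq> carrier G" by auto
  have uc: "u \<in> carrier G" using generate_in_carrier[OF sub u] .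
  have fix_above: "\<pi> v j = j" if "v \<in> generate G (s ` {1..m})" "j = m + 2" for v j
    using that(1)
  proof (induction rule: generate.induct)
    case one
    then show ?case by (simp add: sym_group_one)
  next
    case (incl h)
    then show ?case using Suc.prems(1) that(2) by (auto simp: \<pi>_s Transposition.transpose_def)
  next
    case (inv h)
    then obtain i where i: "1 \<le> i" "i \<le> m" "h = s i" by auto
    then have "inv h = s i" using involution[of i] Suc.prems(1) by (simp add: inv_equality)
    then show ?case using i Suc.prems(1) that(2) by (auto simp: \<pi>_s Transposition.transpose_def)
  next
    case (eng h1 h2)
    then show ?case using generate_in_carrier[OF sub] by (simp add: sym_group_mult)
  qed
  have cycle: "\<pi> (desc k l) k = l + 1" if "k \<le> l + 1" "l < n" for l
    using that
  proof (induction l)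
    case 0
    then show ?case using k by (simp add: sym_group_one)
  next
    case (Suc l)
    then show ?case
      by (cases "k = Suc (Suc l)") (auto simp: sym_group_one sym_group_mult \<pi>_s)
  qed
  have "k = \<pi> x k" using Suc.prems(3) by simp
  also have "\<dots> = \<pi> u (\<pi> (desc k (Suc m)) k)" using x uc by (simp add: sym_group_mult del: desc.simps)
  also have "\<dots> = m + 2" using cycle[of "Suc m"] k Suc.prems(1) fix_above[OF u] by simp
  finally have "x = u" using x uc by (simp add: desc_empty)
  then show ?case using Suc u by simp
qed

end

section \<open>Rotations and Van Buskirk's relations\<close>

text \<open>In contrast to \<open>normal_generateI\<close>, only conjugates by generators of the whole group are
  considered, and they may lie anywhere in the generated subgroup.\<close>

lemma (in group) normal_generateI_generators:
  assumes S: "S \<subseteq> carrier G" and E: "E \<subseteq> carrier G" "carrier G = generate G E"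
    and c1: "\<And>e y. \<lbrakk>e \<in> E; y \<in> S\<rbrakk> \<Longrightarrow> e \<otimes> y \<otimes> inv e \<in> generate G S"
    and c2: "\<And>e y. \<lbrakk>e \<in> E; y \<in> S\<rbrakk> \<Longrightarrow> inv e \<otimes> y \<otimes> e \<in> generate G S"
  shows "generate G S \<lhd> G"
proof (rule normal_invI)
  show sub: "subgroup (generate G S) G" using S by (rule generate_is_subgroup)
  have conj: "g \<otimes> y \<otimes> inv g \<in> generate G S"
    if g: "g \<in> carrier G" "\<And>y. y \<in> S \<Longrightarrow> g \<otimes> y \<otimes> inv g \<in> generate G S" and y: "y \<in> generate G S"
    for g y
    using y
  proof (induction rule: generate.induct)
    case one
    then show ?case using g(1) by (simp add: generate.one)
  next
    case (incl h)
    then show ?case using g by simp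
  next
    case (inv h)
    then have "h \<in> carrier G" using S by auto
    then have "g \<otimes> inv h \<otimes> inv g = inv (g \<otimes> h \<otimes> inv g)"
      using g(1) by (simp add: inv_mult_group m_assoc)
    then show ?case using subgroup.m_inv_closed[OF sub] g inv by simp
  next
    case (eng h1 h2)
    then have "h1 \<in> carrier G" "h2 \<in> carrier G" using generate_in_carrier S by auto
    then have "g \<otimes> (h1 \<otimes> h2) \<otimes> inv g = (g \<otimes> h1 \<otimes> inv g) \<otimes> (g \<otimes> h2 \<otimes> inv g)"
      using g(1) by (simp add: m_assoc inv_solve_left)
    then show ?case using eng generate.eng by metis
  qed
  fix x y assume "x \<in> carrier G" "y \<in> generate G S"
  then have "x \<in> generate G E" "y \<in> generate G S" using E(2) by auto
  then show "x \<otimes> y \<otimes> inv x \<in> generate G S"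
  proof (induction arbitrary: y rule: generate.induct)
    case one
    then show ?case using generate_in_carrier S by auto
  next
    case (incl h)
    then show ?case using conj c1 E(1) by blast
  next
    case (inv h)
    then show ?case using conj[of "inv h"] c2[of h] E(1) by auto
  next
    case (eng h1 h2)
    then have "h1 \<in> carrier G" "h2 \<in> carrier G" "y \<in> carrier G" using generate_in_carrier S E(1) by auto
    then have "h1 \<otimes> h2 \<otimes> y \<otimes> inv (h1 \<otimes> h2) = h1 \<otimes> (h2 \<otimes> y \<otimes> inv h2) \<otimes> inv h1"
      by (simp add: inv_mult_group m_assoc)
    then show ?case using eng by simp
  qed
qed

text \<open>Van Buskirk's relations between elements \<open>s i\<close> and \<open>r j\<close>, written without
  inverses: \<open>r_step\<close> and \<open>r_commutator\<close> are \<open>\<rho>\<^sub>i\<^sub>+\<^sub>1 = \<sigma>\<^sub>i\<inverse> \<rho>\<^sub>i \<sigma>\<^sub>i\<inverse>\<close> and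
  \<open>\<rho>\<^sub>i\<^sub>+\<^sub>1\<inverse> \<rho>\<^sub>i\<inverse> \<rho>\<^sub>i\<^sub>+\<^sub>1 \<rho>\<^sub>i = \<sigma>\<^sub>i\<^sup>2\<close>.\<close>

locale van_buskirk_relations = artin_relations +
  fixes r :: "nat \<Rightarrow> 'a"
  assumes n_ge_2: "n \<ge> 2"
    and r_closed [simp]: "r j \<in> carrier G"
    and s_r_commute: "\<lbrakk>1 \<le> i; i < n; 1 \<le> j; j \<le> n; j \<noteq> i; j \<noteq> i + 1\<rbrakk> \<Longrightarrow>
      s i \<otimes> r j = r j \<otimes> s i"
    and r_step: "\<lbrakk>1 \<le> i; i < n\<rbrakk> \<Longrightarrow> r i = s i \<otimes> (r (i + 1) \<otimes> s i)"
    and r_commutator: "\<lbrakk>1 \<le> i; i < n\<rbrakk> \<Longrightarrow> r i \<otimes> (r (i + 1) \<otimes> (s i \<otimes> s i)) = r (i + 1) \<otimes> r i"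
    and r_square: "r 1 \<otimes> r 1 = asc (n - 1) \<otimes> desc 1 (n - 1)"
begin

text \<open>\<open>rot m\<close> is the element \<open>a\<close> of the first \<open>m\<close> strands, so that \<open>rot n = a\<close> and \<open>rot (n - 1) = b\<close>.\<close>

definition rot :: "nat \<Rightarrow> 'a" where
  "rot m = r m \<otimes> desc 1 (m - 1)"

lemma rot_closed [simp]: "rot m \<in> carrier G"
  by (simp add: rot_def)

lemma rot_step: "\<lbrakk>1 \<le> m; m < n\<rbrakk> \<Longrightarrow> s m \<otimes> rot (m + 1) = rot m"
  using r_step[of m] by (cases m) (simp_all add: rot_def m_assoc)

lemma desc_r_commute: "\<lbrakk>m + 2 \<le> j; j \<le> n\<rbrakk> \<Longrightarrow> desc 1 m \<otimes> r j = r j \<otimes> desc 1 m"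
proof (induction m)
  case (Suc m)
  then have "s (Suc m) \<otimes> (r j \<otimes> desc 1 m) = r j \<otimes> (s (Suc m) \<otimes> desc 1 m)"
    using s_r_commute[of "Suc m" j] by (simp flip: m_assoc)
  then show ?case using Suc by (simp add: m_assoc)
qed simp

lemma rot_s: "\<lbrakk>2 \<le> i; i < m; m \<le> n\<rbrakk> \<Longrightarrow> rot m \<otimes> s i = s (i - 1) \<otimes> rot m"
proof -
  assume A: "2 \<le> i" "i < m" "m \<le> n"
  have "rot m \<otimes> s i = (r m \<otimes> s (i - 1)) \<otimes> desc 1 (m - 1)"
    using A desc_shift[of 1 i "m - 1"] by (simp add: rot_def m_assoc)
  also have "r m \<otimes> s (i - 1) = s (i - 1) \<otimes> r m"
    using A s_r_commute[of "i - 1" m] by simp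
  finally show ?thesis by (simp add: rot_def m_assoc)
qed

lemma rot_r_base:
  assumes "2 \<le> j" "j \<le> n"
  shows "rot j \<otimes> r j = r (j - 1) \<otimes> rot j"
proof -
  obtain i where j: "j = Suc (Suc i)" using assms(1) by (metis Suc_le_D numeral_2_eq_2 Suc_le_mono)
  have "(r j \<otimes> (s (Suc i) \<otimes> r j)) \<otimes> s (Suc i) = r j \<otimes> r (Suc i)"
    using r_step[of "Suc i"] assms j by (simp add: m_assoc)
  also have "\<dots> = (r (Suc i) \<otimes> (r j \<otimes> s (Suc i))) \<otimes> s (Suc i)"
    using r_commutator[of "Suc i"] assms j by (simp add: m_assoc)
  finally have *: "r j \<otimes> (s (Suc i) \<otimes> r j) = r (Suc i) \<otimes> (r j \<otimes> s (Suc i))"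
    by (simp add: right_cancel)
  have "rot j \<otimes> r j = r j \<otimes> (s (Suc i) \<otimes> (r j \<otimes> desc 1 i))"
    using desc_r_commute[of i j] assms j by (simp add: rot_def m_assoc)
  also have "\<dots> = (r j \<otimes> (s (Suc i) \<otimes> r j)) \<otimes> desc 1 i"
    by (simp add: m_assoc)
  also have "\<dots> = r (j - 1) \<otimes> rot j"
    unfolding * using j by (simp add: rot_def m_assoc)
  finally show ?thesis .
qed

text \<open>The step from \<open>m\<close> to \<open>m + 1\<close> cancels \<open>s m\<close>, since \<open>s m\<close> turns \<open>rot (m + 1)\<close> into \<open>rot m\<close> and
commutes with \<open>r (j - 1)\<close>.\<close>

lemma rot_r:
  assumes "2 \<le> j" "j \<le> m" "m \<le> n"
  shows "rot m \<otimes> r j = r (j - 1) \<otimes> rot m"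
  using assms(2,3)
proof (induction m rule: dec_induct)
  case base
  then show ?case using rot_r_base assms(1) by simp
next
  case (step m)
  have m: "s m \<otimes> rot (Suc m) = rot m" using rot_step[of m] step assms(1) by simp
  have "s m \<otimes> (rot (Suc m) \<otimes> r j) = rot m \<otimes> r j"
    by (simp add: m flip: m_assoc)
  also have "\<dots> = r (j - 1) \<otimes> (s m \<otimes> rot (Suc m))"
    using step m by simp
  also have "\<dots> = s m \<otimes> (r (j - 1) \<otimes> rot (Suc m))"
    using s_r_commute[of m "j - 1"] step assms(1) by (simp flip: m_assoc)
  finally show ?case by simp
qed

lemma asc_rot: "m < n \<Longrightarrow> asc m \<otimes> rot (Suc m) = r 1"
proof (induction m)
  case 0
  then show ?case by (simp add: rot_def)
next
  case (Suc m)
  then show ?case using rot_step[of "Suc m"] by (simp add: m_assoc)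
qed

text \<open>Conjugation by \<open>a\<close> lowers the index of \<open>r\<close> by one, and this closes the cycle: \<open>a r 1 a\<inverse> = (r n)\<inverse>\<close>.\<close>

lemma r_rot_r: "r n \<otimes> (rot n \<otimes> r 1) = rot n"
proof -
  have g: "asc (n - 1) \<otimes> rot n = r 1" using asc_rot[of "n - 1"] n_ge_2 by simp
  have "asc (n - 1) \<otimes> (rot n \<otimes> r 1) = asc (n - 1) \<otimes> desc 1 (n - 1)"
    using r_square g by (simp flip: m_assoc)
  then show ?thesis by (simp add: rot_def)
qed

text \<open>The same for the generators \<open>s\<close>: \<open>a\<^sup>2 s 1 a\<^sup>-\<^sup>2 = (s (n - 1))\<inverse>\<close>. Going once around the cycle
therefore inverts every generator.\<close>

lemma s_rot_s: "s (n - 1) \<otimes> (rot n \<otimes> (rot n \<otimes> s 1)) = rot n \<otimes> rot n"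
proof -
  have slide: "rot n \<otimes> desc 1 m = desc 1 (m - 1) \<otimes> (rot n \<otimes> s 1)" if "1 \<le> m" "m < n" for m
    using that
  proof (induction m rule: nat_induct_at_least)
    case base
    then show ?case by simp
  next
    case (Suc m)
    have "rot n \<otimes> desc 1 (Suc m) = s m \<otimes> (rot n \<otimes> desc 1 m)"
      using rot_s[of "Suc m" n] Suc.hyps Suc.prems by (simp flip: m_assoc)
    also have "\<dots> = desc 1 m \<otimes> (rot n \<otimes> s 1)"
      using Suc by (cases m) (simp_all add: m_assoc)
    finally show ?case by simp
  qed
  have "rot n \<otimes> rot n = (rot n \<otimes> r n) \<otimes> desc 1 (n - 1)"
    by (simp add: rot_def m_assoc)
  also have "\<dots> = r (n - 1) \<otimes> (rot n \<otimes> desc 1 (n - 1))"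
    using rot_r[of n n] n_ge_2 by (simp add: m_assoc)
  also have "\<dots> = (r (n - 1) \<otimes> desc 1 (n - 1 - 1)) \<otimes> (rot n \<otimes> s 1)"
    using slide[of "n - 1"] n_ge_2 by (simp add: m_assoc)
  also have "r (n - 1) \<otimes> desc 1 (n - 1 - 1) = s (n - 1) \<otimes> rot n"
    using rot_step[of "n - 1"] n_ge_2 by (simp add: rot_def)
  finally show ?thesis by (simp add: m_assoc)
qed

lemma rot_pow_s: "\<lbrakk>k < i; i < m; m \<le> n\<rbrakk> \<Longrightarrow> rot m [^] k \<otimes> s i = s (i - k) \<otimes> rot m [^] k"
proof (induction k arbitrary: i)
  case (Suc k)
  have "rot m [^] Suc k \<otimes> s i = (rot m [^] k \<otimes> s (i - 1)) \<otimes> rot m"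
    using Suc.prems rot_s[of i m] by (simp add: m_assoc)
  also have "\<dots> = s (i - Suc k) \<otimes> rot m [^] Suc k"
    using Suc.prems Suc.IH[of "i - 1"] by (simp add: m_assoc)
  finally show ?case .
qed simp

lemma rot_pow_r: "\<lbrakk>k < j; j \<le> m; m \<le> n\<rbrakk> \<Longrightarrow> rot m [^] k \<otimes> r j = r (j - k) \<otimes> rot m [^] k"
proof (induction k arbitrary: j)
  case (Suc k)
  have "rot m [^] Suc k \<otimes> r j = (rot m [^] k \<otimes> r (j - 1)) \<otimes> rot m"
    using Suc.prems rot_r[of j m] by (simp add: m_assoc)
  also have "\<dots> = r (j - Suc k) \<otimes> rot m [^] Suc k"
    using Suc.prems Suc.IH[of "j - 1"] by (simp add: m_assoc)
  finally show ?case .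
qed simp

text \<open>Conjugation by \<open>a\<^sup>n\<close> takes \<open>r j\<close> down to \<open>r 1\<close>, then to \<open>(r n)\<inverse>\<close>, then down to \<open>(r j)\<inverse>\<close>. The
inversion is stated as \<open>r j a\<^sup>n r j = a\<^sup>n\<close>.\<close>

lemma rot_pow_inverts_r:
  assumes "1 \<le> j" "j \<le> n"
  shows "r j \<otimes> (rot n [^] n \<otimes> r j) = rot n [^] n"
proof -
  have split: "rot n [^] n = rot n [^] (n - j) \<otimes> (rot n \<otimes> rot n [^] (j - 1))"
    using assms by (simp add: nat_pow_mult flip: nat_pow_Suc2)
  have 1: "rot n [^] (n - j) \<otimes> r n = r j \<otimes> rot n [^] (n - j)"
    using rot_pow_r[of "n - j" n n] assms by simp
  have 2: "rot n [^] (j - 1) \<otimes> r j = r 1 \<otimes> rot n [^] (j - 1)"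
    using rot_pow_r[of "j - 1" j n] assms by simp
  have "r j \<otimes> (rot n [^] n \<otimes> r j)
      = (r j \<otimes> rot n [^] (n - j)) \<otimes> (rot n \<otimes> (rot n [^] (j - 1) \<otimes> r j))"
    unfolding split by (simp add: m_assoc)
  also have "\<dots> = rot n [^] (n - j) \<otimes> ((r n \<otimes> (rot n \<otimes> r 1)) \<otimes> rot n [^] (j - 1))"
    unfolding 1[symmetric] 2 by (simp add: m_assoc)
  finally show ?thesis unfolding r_rot_r split[symmetric] .
qed

lemma rot_pow_inverts_s:
  assumes "1 \<le> i" "i < n"
  shows "s i \<otimes> (rot n [^] n \<otimes> s i) = rot n [^] n"
proof -
  have "n = (n - 1 - i) + Suc (Suc (i - 1))" using assms by simp
  then have split: "rot n [^] n = rot n [^] (n - 1 - i) \<otimes> (rot n \<otimes> (rot n \<otimes> rot n [^] (i - 1)))"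
    by (metis nat_pow_mult nat_pow_Suc2 rot_closed)
  have 1: "rot n [^] (n - 1 - i) \<otimes> s (n - 1) = s i \<otimes> rot n [^] (n - 1 - i)"
    using rot_pow_s[of "n - 1 - i" "n - 1" n] assms by simp
  have 2: "rot n [^] (i - 1) \<otimes> s i = s 1 \<otimes> rot n [^] (i - 1)"
    using rot_pow_s[of "i - 1" i n] assms by simp
  have "s i \<otimes> (rot n [^] n \<otimes> s i)
      = (s i \<otimes> rot n [^] (n - 1 - i)) \<otimes> (rot n \<otimes> (rot n \<otimes> (rot n [^] (i - 1) \<otimes> s i)))"
    unfolding split by (simp add: m_assoc)
  also have "\<dots> = rot n [^] (n - 1 - i) \<otimes>
      ((s (n - 1) \<otimes> (rot n \<otimes> (rot n \<otimes> s 1))) \<otimes> rot n [^] (i - 1))"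
    unfolding 1[symmetric] 2 by (simp add: m_assoc)
  also have "\<dots> = rot n [^] n" unfolding s_rot_s split by (simp add: m_assoc)
  finally show ?thesis .
qed

text \<open>As \<open>rot m = s m rot (m + 1)\<close> and \<open>rot (m + 1)\<close> shifts the generators \<open>s\<close>, the power \<open>(rot m)\<^sup>m\<close>
unwinds to \<open>s m s (m - 1) \<dots> s 1 (rot (m + 1))\<^sup>m\<close>. In particular \<open>a\<^sup>n = r n b\<^sup>n\<^sup>-\<^sup>1\<close> and, by iteration,
\<open>a\<^sup>n = r n \<dots> r 1\<close>.\<close>

lemma rot_pow_Suc:
  assumes "1 \<le> m" "m < n"
  shows "rot (Suc m) [^] Suc m = r (Suc m) \<otimes> rot m [^] m"
proof -
  let ?A = "rot (Suc m)" and ?B = "rot m"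
  have B: "?B = s m \<otimes> ?A" using rot_step[of m] assms by simp
  have "?B [^] k \<otimes> (inv (?A [^] k) \<otimes> desc 1 (m - k)) = desc 1 m" if "k \<le> m" for k
    using that
  proof (induction k)
    case (Suc k)
    then obtain l where l: "m - k = Suc l" by (cases "m - k") auto
    have lk: "m - Suc k = l" using l by simp
    have "?A [^] k \<otimes> s m = s (Suc l) \<otimes> ?A [^] k"
      using rot_pow_s[of k m "Suc m"] Suc.prems assms l by simp
    then have slide: "inv (?A [^] k) \<otimes> s (Suc l) = s m \<otimes> inv (?A [^] k)"
      by (metis inv_closed inv_solve_left inv_solve_right m_assoc m_closed nat_pow_closed
          rot_closed s_closed)
    have "s m \<otimes> inv (?A [^] k) = ?B \<otimes> inv (?A [^] Suc k)"
    proof -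
      have "inv (?A [^] Suc k) = inv ?A \<otimes> inv (?A [^] k)" by (simp add: inv_mult_group)
      moreover have "?A \<otimes> (inv ?A \<otimes> inv (?A [^] k)) = inv (?A [^] k)"
        by (simp flip: m_assoc)
      ultimately show ?thesis by (simp add: B m_assoc)
    qed
    then have "?B [^] Suc k \<otimes> (inv (?A [^] Suc k) \<otimes> desc 1 (m - Suc k))
        = ?B [^] k \<otimes> ((s m \<otimes> inv (?A [^] k)) \<otimes> desc 1 l)"
      by (simp add: m_assoc lk del: nat_pow_Suc)
    also have "\<dots> = ?B [^] k \<otimes> (inv (?A [^] k) \<otimes> desc 1 (m - k))"
      unfolding slide[symmetric] l by (simp add: m_assoc)
    also have "\<dots> = desc 1 m" using Suc by simp
    finally show ?case .
  qed simp
  from this[of m] have "?B [^] m \<otimes> inv (?A [^] m) = desc 1 m" by simp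
  then have "?B [^] m = desc 1 m \<otimes> ?A [^] m"
    by (metis inv_solve_right' nat_pow_closed rot_closed desc_closed)
  moreover have "?A [^] Suc m = r (Suc m) \<otimes> (desc 1 m \<otimes> ?A [^] m)"
    by (simp only: nat_pow_Suc2 rot_closed) (simp add: rot_def m_assoc)
  ultimately show ?thesis by simp
qed

primrec r_desc :: "nat \<Rightarrow> 'a" where
  "r_desc 0 = \<one>"
| "r_desc (Suc k) = r (Suc k) \<otimes> r_desc k"

primrec r_asc :: "nat \<Rightarrow> 'a" where
  "r_asc 0 = \<one>"
| "r_asc (Suc k) = r_asc k \<otimes> r (Suc k)"

lemma r_desc_closed [simp]: "r_desc k \<in> carrier G"
  by (induction k) auto

lemma r_asc_closed [simp]: "r_asc k \<in> carrier G"
  by (induction k) auto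

lemma rot_pow_eq_r_desc: "\<lbrakk>1 \<le> m; m \<le> n\<rbrakk> \<Longrightarrow> rot m [^] m = r_desc m"
proof (induction m rule: nat_induct_at_least)
  case base
  then show ?case by (simp add: rot_def)
next
  case (Suc m)
  then show ?case using rot_pow_Suc[of m] by (simp del: nat_pow_Suc)
qed

text \<open>With \<open>g = s 1 \<dots> s (n - 1)\<close> one has \<open>g a = r 1\<close>. Expanding \<open>g\<^sup>k a\<^sup>k\<close> from the inside, each new
factor \<open>g a = r 1\<close> moves right across \<open>a\<^sup>k\<close> and becomes \<open>r (k + 1)\<close>.\<close>

lemma asc_pow_rot_pow: "k \<le> n \<Longrightarrow> asc (n - 1) [^] k \<otimes> rot n [^] k = r_asc k"
proof (induction k)
  case (Suc k)
  have g: "asc (n - 1) \<otimes> rot n = r 1" using asc_rot[of "n - 1"] n_ge_2 by simp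
  have "asc (n - 1) [^] Suc k \<otimes> rot n [^] Suc k
      = asc (n - 1) [^] k \<otimes> ((asc (n - 1) \<otimes> rot n) \<otimes> rot n [^] k)"
    unfolding nat_pow_Suc2[OF rot_closed] by (simp add: m_assoc)
  also have "\<dots> = (asc (n - 1) [^] k \<otimes> rot n [^] k) \<otimes> r (Suc k)"
    unfolding g using rot_pow_r[of k "Suc k" n] Suc.prems by (simp add: m_assoc)
  finally show ?case using Suc by simp
qed simp

text \<open>The full twist is \<open>g\<^sup>n\<close>. By the previous lemma \<open>g\<^sup>n a\<^sup>n = r 1 \<dots> r n\<close>. Since \<open>a\<^sup>n\<close> inverts every
\<open>r j\<close> and equals \<open>r n \<dots> r 1\<close>, also \<open>r 1 \<dots> r n = a\<^sup>-\<^sup>n\<close>; hence \<open>g\<^sup>n = a\<^sup>-\<^sup>2\<^sup>n\<close>.\<close>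

lemma asc_pow_eq: "asc (n - 1) [^] n = inv (rot n [^] n \<otimes> rot n [^] n)"
proof -
  let ?c = "rot n [^] n"
  have "r_asc k \<otimes> (?c \<otimes> r_desc k) = ?c" if "k \<le> n" for k
    using that
  proof (induction k)
    case (Suc k)
    have "r_asc (Suc k) \<otimes> (?c \<otimes> r_desc (Suc k))
        = r_asc k \<otimes> ((r (Suc k) \<otimes> (?c \<otimes> r (Suc k))) \<otimes> r_desc k)"
      by (simp add: m_assoc)
    then show ?case using rot_pow_inverts_r[of "Suc k"] Suc by simp
  qed simp
  from this[of n] have "r_asc n \<otimes> ?c \<otimes> ?c = ?c"
    using rot_pow_eq_r_desc[of n] n_ge_2 by (simp add: m_assoc)
  then have "r_asc n \<otimes> ?c = \<one>" by (simp add: r_cancel_one)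
  then have "asc (n - 1) [^] n \<otimes> (?c \<otimes> ?c) = \<one>"
    using asc_pow_rot_pow[of n] by (simp flip: m_assoc)
  then show ?thesis by (simp add: inv_equality)
qed

lemma rot_pow_eq: "rot n [^] n = r n \<otimes> rot (n - 1) [^] (n - 1)"
  using rot_pow_Suc[of "n - 1"] n_ge_2 by (simp del: nat_pow_Suc)

lemma rot_pred_pow_square:
  "rot (n - 1) [^] (n - 1) \<otimes> rot (n - 1) [^] (n - 1) = rot n [^] n \<otimes> rot n [^] n"
proof -
  let ?c = "rot n [^] n" and ?d = "rot (n - 1) [^] (n - 1)"
  have "r n \<otimes> (?c \<otimes> r n) = r n \<otimes> ?d"
    using rot_pow_inverts_r[of n] n_ge_2 rot_pow_eq by simp
  then have "?c \<otimes> r n = ?d" by simp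
  then have "?d \<otimes> ?d = ?c \<otimes> (r n \<otimes> ?d)" by (simp flip: m_assoc)
  then show ?thesis unfolding rot_pow_eq[symmetric] .
qed

text \<open>\<open>a\<^sup>n\<close> inverts every generator under conjugation, so its square commutes with every generator.\<close>

lemma full_twist_commutes:
  assumes "x \<in> s ` {1..n - 1} \<union> r ` {1..n}"
  shows "x \<otimes> asc (n - 1) [^] n = asc (n - 1) [^] n \<otimes> x"
proof -
  let ?c = "rot n [^] n"
  have x: "x \<in> carrier G" "x \<otimes> (?c \<otimes> x) = ?c"
    using assms rot_pow_inverts_r rot_pow_inverts_s by auto
  have "x \<otimes> (?c \<otimes> ?c) = x \<otimes> (?c \<otimes> (x \<otimes> (?c \<otimes> x)))" using x by simp
  also have "\<dots> = (x \<otimes> (?c \<otimes> x)) \<otimes> (?c \<otimes> x)" using x(1) by (simp add: m_assoc)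
  also have "\<dots> = (?c \<otimes> ?c) \<otimes> x" unfolding x(2) using x(1) by (simp add: m_assoc)
  finally have "x \<otimes> (?c \<otimes> ?c) = (?c \<otimes> ?c) \<otimes> x" .
  then show ?thesis
    unfolding asc_pow_eq using x(1)
    by (metis inv_closed inv_solve_left inv_solve_right m_assoc m_closed nat_pow_closed rot_closed)
qed

definition rot_conj :: "nat \<Rightarrow> 'a" where
  "rot_conj k = rot n [^] k \<otimes> rot (n - 1) [^] (n - 1) \<otimes> inv (rot n [^] k)"

lemma rot_conj_closed [simp]: "rot_conj k \<in> carrier G"
  by (simp add: rot_conj_def)

lemma rot_conj_square: "rot_conj k \<otimes> rot_conj k = rot n [^] n \<otimes> rot n [^] n"
proof -
  let ?a = "rot n [^] k" and ?d = "rot (n - 1) [^] (n - 1)"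
  have c: "?a \<otimes> rot n [^] n = rot n [^] n \<otimes> ?a"
    by (simp add: nat_pow_mult add.commute)
  have "inv ?a \<otimes> (?a \<otimes> x) = x" if "x \<in> carrier G" for x
    using that by (simp flip: m_assoc)
  then have "rot_conj k \<otimes> rot_conj k = ?a \<otimes> ((?d \<otimes> ((inv ?a \<otimes> ?a) \<otimes> ?d)) \<otimes> inv ?a)"
    by (simp add: rot_conj_def m_assoc)
  also have "\<dots> = ?a \<otimes> ((?d \<otimes> ?d) \<otimes> inv ?a)"
    by simp
  also have "\<dots> = (?a \<otimes> rot n [^] n) \<otimes> (rot n [^] n \<otimes> inv ?a)"
    unfolding rot_pred_pow_square by (simp add: m_assoc)
  also have "\<dots> = rot n [^] n \<otimes> ((?a \<otimes> rot n [^] n) \<otimes> inv ?a)"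
    by (subst c) (simp add: m_assoc)
  also have "\<dots> = rot n [^] n \<otimes> rot n [^] n"
    unfolding c by (simp add: m_assoc)
  finally show ?thesis .
qed

text \<open>Conjugating \<open>a\<^sup>n = r n b\<^sup>n\<^sup>-\<^sup>1\<close> by \<open>a\<^sup>k\<close>.\<close>

lemma r_times_rot_conj:
  assumes "k < n"
  shows "r (n - k) \<otimes> rot_conj k = rot n [^] n"
proof -
  let ?a = "rot n [^] k" and ?d = "rot (n - 1) [^] (n - 1)"
  have c: "?a \<otimes> rot n [^] n = rot n [^] n \<otimes> ?a"
    by (simp add: nat_pow_mult add.commute)
  have "r (n - k) \<otimes> rot_conj k = (r (n - k) \<otimes> ?a) \<otimes> (?d \<otimes> inv ?a)"
    by (simp add: rot_conj_def m_assoc)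
  also have "\<dots> = ?a \<otimes> ((r n \<otimes> ?d) \<otimes> inv ?a)"
    using rot_pow_r[of k n n] assms by (simp add: m_assoc flip: rot_pow_r)
  also have "\<dots> = (?a \<otimes> rot n [^] n) \<otimes> inv ?a"
    unfolding rot_pow_eq[symmetric] by (simp add: m_assoc)
  also have "\<dots> = (rot n [^] n \<otimes> ?a) \<otimes> inv ?a"
    unfolding c ..
  finally show ?thesis by (simp add: m_assoc)
qed

text \<open>The formula \<open>a\<^sup>n = r (n - k) rot_conj k\<close> recovers \<open>r 2, \<dots>, r n\<close> from the elements on the left, and
\<open>a\<^sup>n = r n \<dots> r 1\<close> then gives \<open>r 1\<close>.\<close>

lemma generate_rot_powers:
  "generate G (insert (rot n [^] n) (rot_conj ` {0..n - 2})) = generate G (r ` {1..n})"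
    (is "generate G ?T = generate G ?R")
proof (rule antisym)
  have R: "subgroup (generate G ?R) G" by (rule generate_is_subgroup) auto
  have T: "subgroup (generate G ?T) G" by (rule generate_is_subgroup) auto
  have rR: "r j \<in> generate G ?R" if "1 \<le> j" "j \<le> n" for j
    using that by (intro generate.incl) auto
  have "r_desc k \<in> generate G ?R" if "k \<le> n" for k
    using that
  proof (induction k)
    case (Suc k)
    then show ?case using rR[of "Suc k"] by (simp add: generate.eng)
  qed (simp add: generate.one)
  then have c: "rot n [^] n \<in> generate G ?R" using rot_pow_eq_r_desc[of n] n_ge_2 by simp
  have "rot_conj k \<in> generate G ?R" if "k \<le> n - 2" for k
  proof -
    have "rot_conj k = inv (r (n - k)) \<otimes> rot n [^] n"
      using r_times_rot_conj[of k] that n_ge_2 by (simp add: inv_solve_left)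
    moreover have "inv (r (n - k)) \<in> generate G ?R"
      using that n_ge_2 by (intro subgroup.m_inv_closed[OF R] rR) auto
    ultimately show ?thesis using generate.eng c by metis
  qed
  then show "generate G ?T \<subseteq> generate G ?R"
    using c by (intro generate_subgroup_incl[OF _ R] insert_subsetI image_subsetI) simp_all
  have cT: "rot n [^] n \<in> generate G ?T" by (rule generate.incl) simp
  have rT: "r j \<in> generate G ?T" if "2 \<le> j" "j \<le> n" for j
  proof -
    have "r j = rot n [^] n \<otimes> inv (rot_conj (n - j))"
      using r_times_rot_conj[of "n - j"] that by (simp add: inv_solve_right)
    moreover have "inv (rot_conj (n - j)) \<in> generate G ?T"
      using that by (intro subgroup.m_inv_closed[OF T] generate.incl) auto
    ultimately show ?thesis using generate.eng cT by metis
  qed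
  have "\<exists>x\<in>generate G ?T. r_desc m = x \<otimes> r 1" if "1 \<le> m" "m \<le> n" for m
    using that
  proof (induction m rule: nat_induct_at_least)
    case base
    then show ?case by (intro bexI[of _ \<one>] generate.one) simp
  next
    case (Suc m)
    then obtain x where x: "x \<in> generate G ?T" "r_desc m = x \<otimes> r 1" by auto
    then have "x \<in> carrier G" using subgroup.mem_carrier[OF T] by blast
    then have "r_desc (Suc m) = (r (Suc m) \<otimes> x) \<otimes> r 1" using x by (simp add: m_assoc)
    moreover have "r (Suc m) \<otimes> x \<in> generate G ?T"
      using x Suc by (intro generate.eng rT) auto
    ultimately show ?case by blast
  qed
  from this[of n] obtain x where x: "x \<in> generate G ?T" "rot n [^] n = x \<otimes> r 1"
    using rot_pow_eq_r_desc[of n] n_ge_2 by auto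
  then have "r 1 = inv x \<otimes> rot n [^] n"
    using subgroup.mem_carrier[OF T x(1)] by (simp add: inv_solve_left)
  then have "r 1 \<in> generate G ?T"
    using subgroup.m_inv_closed[OF T x(1)] cT generate.eng by metis
  then have "r j \<in> generate G ?T" if "1 \<le> j" "j \<le> n" for j
    using that rT by (cases "j = 1") auto
  then show "generate G ?R \<subseteq> generate G ?T"
    by (intro generate_subgroup_incl[OF _ T]) auto
qed

lemma s_square_mem:
  assumes "1 \<le> i" "i < n"
  shows "s i \<otimes> s i \<in> generate G (r ` {1..n})"
proof -
  have R: "subgroup (generate G (r ` {1..n})) G" by (rule generate_is_subgroup) auto
  have "s i \<otimes> s i = inv (r (i + 1)) \<otimes> (inv (r i) \<otimes> (r (i + 1) \<otimes> r i))"
    using r_commutator[of i] assms by (simp add: inv_solve_left inv_solve_left')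
  moreover have "r i \<in> generate G (r ` {1..n})" "r (i + 1) \<in> generate G (r ` {1..n})"
    using assms by (auto intro!: generate.incl)
  ultimately show ?thesis
    using subgroup.m_closed[OF R] subgroup.m_inv_closed[OF R] by simp
qed

text \<open>Conjugation by \<open>s i\<close> exchanges \<open>r i\<close> and \<open>r (i + 1)\<close> up to factors \<open>(s i)\<^sup>2\<close>, and \<open>(s i)\<^sup>2\<close> is a
commutator of elements \<open>r\<close>.\<close>

lemma generate_r_normal:
  assumes gen: "carrier G = generate G (s ` {1..n - 1} \<union> r ` {1..n})"
  shows "generate G (r ` {1..n}) \<lhd> G"
proof -
  let ?R = "generate G (r ` {1..n})"
  have R: "subgroup ?R G" by (rule generate_is_subgroup) auto
  have rR: "r j \<in> ?R" if "1 \<le> j" "j \<le> n" for j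
    using that by (intro generate.incl) auto
  have s2: "s i \<otimes> s i \<in> ?R" if "1 \<le> i" "i < n" for i
    by (rule s_square_mem) fact+
  show ?thesis
  proof (rule normal_generateI_generators[OF _ _ gen])
    fix e y assume e: "e \<in> s ` {1..n - 1} \<union> r ` {1..n}" and y: "y \<in> r ` {1..n}"
    have "e \<otimes> y \<otimes> inv e \<in> ?R \<and> inv e \<otimes> y \<otimes> e \<in> ?R"
    proof (cases "e \<in> r ` {1..n}")
      case True
      then have "e \<in> ?R" "y \<in> ?R" using y by (auto intro: generate.incl)
      then show ?thesis
        by (intro conjI subgroup.m_closed[OF R] subgroup.m_inv_closed[OF R])
    next
      case False
      then obtain i j where i: "1 \<le> i" "i < n" "e = s i" and j: "1 \<le> j" "j \<le> n" "y = r j"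
        using e y n_ge_2 by force
      let ?q = "s i \<otimes> s i" and ?r' = "r (Suc i)"
      have cancel: "s i \<otimes> (inv (s i) \<otimes> x) = x" "inv (s i) \<otimes> (s i \<otimes> x) = x"
        if "x \<in> carrier G" for x
        using that by (simp_all flip: m_assoc)
      have ri: "r i = s i \<otimes> (?r' \<otimes> s i)" using r_step[of i] i by simp
      have iq: "inv ?q = inv (s i) \<otimes> inv (s i)" by (simp add: inv_mult_group)
      have mem: "?q \<in> ?R" "inv ?q \<in> ?R" "r i \<in> ?R" "?r' \<in> ?R"
        using s2 subgroup.m_inv_closed[OF R s2] rR i by auto
      consider "j = i" | "j = Suc i" | "j \<noteq> i" "j \<noteq> i + 1" by linarith
      then show ?thesis
      proof cases
        case 1
        have "s i \<otimes> r i \<otimes> inv (s i) = ?q \<otimes> ?r'" "inv (s i) \<otimes> r i \<otimes> s i = ?r' \<otimes> ?q"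
          unfolding ri by (simp_all add: m_assoc cancel)
        then show ?thesis using 1 i j mem generate.eng by metis
      next
        case 2
        have "s i \<otimes> ?r' \<otimes> inv (s i) = r i \<otimes> inv ?q" "inv (s i) \<otimes> ?r' \<otimes> s i = inv ?q \<otimes> r i"
          unfolding ri iq by (simp_all add: m_assoc cancel)
        then show ?thesis using 2 i j mem generate.eng by metis
      next
        case 3
        then have c: "s i \<otimes> r j = r j \<otimes> s i" using s_r_commute[of i j] i j by simp
        have "s i \<otimes> r j \<otimes> inv (s i) = r j"
          unfolding c by (simp add: m_assoc)
        moreover have "inv (s i) \<otimes> r j \<otimes> s i = r j"
          by (simp add: m_assoc cancel flip: c)
        ultimately show ?thesis using i j rR by simp
      qed
    qed
    then show "e \<otimes> y \<otimes> inv e \<in> ?R" "inv e \<otimes> y \<otimes> e \<in> ?R" by auto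
  qed auto
qed

text \<open>The pure subgroup is generated by the elements \<open>r j\<close>. Modulo them every \<open>s i\<close> is an involution, so the
quotient satisfies the Coxeter relations and acts faithfully by permutations.\<close>

theorem pure_subgroup_generated:
  assumes gen: "carrier G = generate G (s ` {1..n - 1} \<union> r ` {1..n})"
    and \<pi>: "\<pi> \<in> hom G (sym_group n)"
    and \<pi>_s: "\<And>i. \<lbrakk>1 \<le> i; i < n\<rbrakk> \<Longrightarrow> \<pi> (s i) = Transposition.transpose i (i + 1)"
    and \<pi>_r: "\<And>j. \<lbrakk>1 \<le> j; j \<le> n\<rbrakk> \<Longrightarrow> \<pi> (r j) = id"
  shows "kernel G (sym_group n) \<pi> = generate G (r ` {1..n})"
proof
  let ?R = "generate G (r ` {1..n})" and ?q = "\<lambda>x. generate G (r ` {1..n}) #> x"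
  interpret \<pi>: group_hom G "sym_group n" \<pi>
    using \<pi> sym_group_is_group by (simp add: group_hom_def group_hom_axioms_def)
  show RK: "?R \<subseteq> kernel G (sym_group n) \<pi>"
    using \<pi>_r by (intro generate_subgroup_incl[OF _ \<pi>.subgroup_kernel]) (auto simp: kernel_def sym_group_one)
  interpret R: normal ?R G by (rule generate_r_normal[OF gen])
  interpret Q: group "G Mod ?R" by (rule R.factorgroup_is_group)
  interpret q: group_hom G "G Mod ?R" ?q
    by (intro group_hom.intro group_hom_axioms.intro Q.is_group is_group R.r_coset_hom_Mod)
  obtain p where p: "p \<in> hom (G Mod ?R) (sym_group n)" "\<And>x. x \<in> carrier G \<Longrightarrow> p (?q x) = \<pi> x"
    using hom_FactGroup_factor[OF \<pi> sym_group_is_group R.normal_axioms] RK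
    by (auto simp: kernel_def)
  have one: "?q x = \<one>\<^bsub>G Mod ?R\<^esub>" if "x \<in> ?R" for x
    using that coset_join2[OF _ R.subgroup_axioms] by auto
  interpret Q: coxeter_relations "G Mod ?R" "\<lambda>i. ?q (s i)" n
  proof
    fix i j :: nat
    show "?q (s i) \<in> carrier (G Mod ?R)" by (rule q.hom_closed) simp
    show "?q (s i) \<otimes>\<^bsub>G Mod ?R\<^esub> ?q (s j) = ?q (s j) \<otimes>\<^bsub>G Mod ?R\<^esub> ?q (s i)"
      if "1 \<le> i" "i + 2 \<le> j" "j < n"
      using far_commute[OF that] by (metis q.hom_mult s_closed)
    show "?q (s i) \<otimes>\<^bsub>G Mod ?R\<^esub> (?q (s (i + 1)) \<otimes>\<^bsub>G Mod ?R\<^esub> ?q (s i)) =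
        ?q (s (i + 1)) \<otimes>\<^bsub>G Mod ?R\<^esub> (?q (s i) \<otimes>\<^bsub>G Mod ?R\<^esub> ?q (s (i + 1)))"
      if "1 \<le> i" "i + 1 < n"
      using braid[OF that] by (metis q.hom_mult s_closed m_closed)
    show "?q (s i) \<otimes>\<^bsub>G Mod ?R\<^esub> ?q (s i) = \<one>\<^bsub>G Mod ?R\<^esub>" if "1 \<le> i" "i < n"
      using one[OF s_square_mem[OF that]] by (metis q.hom_mult s_closed)
  qed
  show "kernel G (sym_group n) \<pi> \<subseteq> ?R"
  proof
    fix x assume "x \<in> kernel G (sym_group n) \<pi>"
    then have x: "x \<in> carrier G" "\<pi> x = id" by (auto simp: kernel_def sym_group_one)
    let ?S = "(\<lambda>i. ?q (s i)) ` {1..n - 1}"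
    have "subgroup (generate (G Mod ?R) ?S) (G Mod ?R)"
      by (rule Q.generate_is_subgroup) (use q.hom_closed in auto)
    moreover have "?q ` (s ` {1..n - 1} \<union> r ` {1..n}) \<subseteq> generate (G Mod ?R) ?S"
    proof (intro image_subsetI)
      fix e assume "e \<in> s ` {1..n - 1} \<union> r ` {1..n}"
      then show "?q e \<in> generate (G Mod ?R) ?S"
      proof
        assume "e \<in> r ` {1..n}"
        then have "?q e = \<one>\<^bsub>G Mod ?R\<^esub>" by (intro one generate.incl)
        then show ?thesis by (simp only: generate.one)
      qed (auto intro: generate.incl)
    qed
    ultimately have "generate (G Mod ?R) (?q ` (s ` {1..n - 1} \<union> r ` {1..n})) \<subseteq> generate (G Mod ?R) ?S"
      by (rule Q.generate_subgroup_incl[rotated])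
    moreover have "?q ` carrier G = generate (G Mod ?R) (?q ` (s ` {1..n - 1} \<union> r ` {1..n}))"
      by (subst gen, subst q.generate_img) auto
    ultimately have "?q x \<in> generate (G Mod ?R) ?S" using x(1) by blast
    moreover have "p (?q x) = id" using p(2) x by simp
    ultimately have "?q x = \<one>\<^bsub>G Mod ?R\<^esub>"
      using p n_ge_2 \<pi>_s by (intro Q.faithful_permutation_action[of p "n - 1"]) auto
    then have "?q x = ?R" by simp
    then show "x \<in> ?R" using x(1) rcos_self[of x] R.subgroup_axioms by blast
  qed
qed

end

section \<open>The braid group of the projective plane\<close>

text \<open>Outside the range of indices the values are set to one, which makes membership in the group
unconditional.\<close>

definition sigma_braid :: "nat \<Rightarrow> nat \<Rightarrow> braid_gen word set" where
  "sigma_braid n i = (if 1 \<le> i \<and> i < n then braid_of n [sg i] else \<one>\<^bsub>RP2_braid_group n\<^esub>)"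

definition rho_braid :: "nat \<Rightarrow> nat \<Rightarrow> braid_gen word set" where
  "rho_braid n j = (if 1 \<le> j \<and> j \<le> n then braid_of n [rh j] else \<one>\<^bsub>RP2_braid_group n\<^esub>)"

lemma group_RP2_braid_group: "group (RP2_braid_group n)"
  by (simp add: RP2_braid_group_def group_presented_group)

lemma carrier_RP2_braid_group:
  "carrier (RP2_braid_group n) = braid_of n ` words_over (braid_gens n)"
  by (simp add: RP2_braid_group_def braid_of_def presented_group_def)

lemma one_RP2_braid_group: "\<one>\<^bsub>RP2_braid_group n\<^esub> = braid_of n []"
  by (simp add: RP2_braid_group_def braid_of_def presented_group_def)

lemma words_over_simps [simp]:
  "[] \<in> words_over S" "x # w \<in> words_over S \<longleftrightarrow> fst x \<in> S \<and> w \<in> words_over S"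
  "u @ v \<in> words_over S \<longleftrightarrow> u \<in> words_over S \<and> v \<in> words_over S"
  by (cases x; auto simp: words_over_def)+

lemma braid_gens_simps [simp]:
  "BSigma i \<in> braid_gens n \<longleftrightarrow> 1 \<le> i \<and> i < n" "BRho j \<in> braid_gens n \<longleftrightarrow> 1 \<le> j \<and> j \<le> n"
  by (auto simp: braid_gens_def)

lemma braid_of_append:
  assumes "u \<in> words_over (braid_gens n)" "v \<in> words_over (braid_gens n)"
  shows "braid_of n (u @ v) = braid_of n u \<otimes>\<^bsub>RP2_braid_group n\<^esub> braid_of n v"
  using assms by (simp add: RP2_braid_group_def braid_of_def presented_group_mult)

lemma braid_of_eqI:
  assumes "u \<in> words_over (braid_gens n)" "v \<in> words_over (braid_gens n)"
    "word_cong (braid_gens n) (braid_rels n) u v"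
  shows "braid_of n u = braid_of n v"
  using assms by (simp add: braid_of_def word_class_eq_iff)

fun braid_letter :: "nat \<Rightarrow> braid_gen \<times> bool \<Rightarrow> braid_gen word set" where
  "braid_letter n (BSigma i, e) = (if e then sigma_braid n i else inv\<^bsub>RP2_braid_group n\<^esub> sigma_braid n i)"
| "braid_letter n (BRho j, e) = (if e then rho_braid n j else inv\<^bsub>RP2_braid_group n\<^esub> rho_braid n j)"

lemma braid_of_closed: "w \<in> words_over (braid_gens n) \<Longrightarrow> braid_of n w \<in> carrier (RP2_braid_group n)"
  by (simp add: carrier_RP2_braid_group)

lemma sigma_braid_closed: "sigma_braid n i \<in> carrier (RP2_braid_group n)"
  and rho_braid_closed: "rho_braid n j \<in> carrier (RP2_braid_group n)"
  using group.is_monoid[OF group_RP2_braid_group[of n]]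
  by (simp_all add: sigma_braid_def rho_braid_def braid_of_closed monoid.one_closed)

lemma braid_of_inverse_letter:
  assumes "g \<in> braid_gens n"
  shows "braid_of n [(g, False)] = inv\<^bsub>RP2_braid_group n\<^esub> braid_of n [(g, True)]"
proof -
  interpret B: group "RP2_braid_group n" by (rule group_RP2_braid_group)
  have "braid_of n ([(g, False)] @ [(g, True)]) = braid_of n []"
    using assms word_cong.cancel[of g "braid_gens n" "braid_rels n" False]
    by (intro braid_of_eqI) simp_all
  then have "braid_of n [(g, False)] \<otimes>\<^bsub>RP2_braid_group n\<^esub> braid_of n [(g, True)] = \<one>\<^bsub>RP2_braid_group n\<^esub>"
    using assms by (subst (asm) braid_of_append) (simp_all add: one_RP2_braid_group)
  then show ?thesis
    using assms by (intro B.inv_equality[symmetric]) (simp_all add: braid_of_closed)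
qed

lemma braid_letter_eq: "fst x \<in> braid_gens n \<Longrightarrow> braid_letter n x = braid_of n [x]"
  by (cases "(n, x)" rule: braid_letter.cases) (auto simp: sigma_braid_def rho_braid_def braid_of_inverse_letter)

lemma braid_of_Cons:
  assumes "fst x \<in> braid_gens n" "w \<in> words_over (braid_gens n)"
  shows "braid_of n (x # w) = braid_letter n x \<otimes>\<^bsub>RP2_braid_group n\<^esub> braid_of n w"
  using braid_of_append[of "[x]" n w] assms by (simp add: braid_letter_eq)

lemma braid_relation:
  assumes "(u, v) \<in> braid_rels n" "u \<in> words_over (braid_gens n)" "v \<in> words_over (braid_gens n)"
  shows "braid_of n u = braid_of n v"
  using assms by (intro braid_of_eqI word_cong.rel)

lemma words_over_map: "map f xs \<in> words_over S \<longleftrightarrow> (\<forall>x\<in>set xs. fst (f x) \<in> S)"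
  by (induction xs) auto

lemma artin_relations_sigma: "artin_relations (RP2_braid_group n) (sigma_braid n) n"
proof -
  interpret B: group "RP2_braid_group n" by (rule group_RP2_braid_group)
  note [simp] = braid_of_Cons sigma_braid_closed rho_braid_closed one_RP2_braid_group[symmetric]
  show ?thesis
  proof
    show "sigma_braid n i \<in> carrier (RP2_braid_group n)" for i by simp
    show "sigma_braid n i \<otimes>\<^bsub>RP2_braid_group n\<^esub> sigma_braid n j = sigma_braid n j \<otimes>\<^bsub>RP2_braid_group n\<^esub> sigma_braid n i"
      if "1 \<le> i" "i + 2 \<le> j" "j < n" for i j
    proof -
      have "braid_of n [sg i, sg j] = braid_of n [sg j, sg i]"
        using that by (intro braid_relation) (auto simp: braid_rels_def)
      then show ?thesis using that by simp
    qed
    show "sigma_braid n i \<otimes>\<^bsub>RP2_braid_group n\<^esub> (sigma_braid n (i + 1) \<otimes>\<^bsub>RP2_braid_group n\<^esub> sigma_braid n i) =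
        sigma_braid n (i + 1) \<otimes>\<^bsub>RP2_braid_group n\<^esub> (sigma_braid n i \<otimes>\<^bsub>RP2_braid_group n\<^esub> sigma_braid n (i + 1))"
      if "1 \<le> i" "i + 1 < n" for i
    proof -
      have "braid_of n [sg i, sg (i + 1), sg i] = braid_of n [sg (i + 1), sg i, sg (i + 1)]"
        using that by (intro braid_relation) (auto simp: braid_rels_def)
      then show ?thesis using that by simp
    qed
  qed
qed

lemma braid_of_asc:
  "m < n \<Longrightarrow> braid_of n (map sg [1..<Suc m]) =
    artin_relations.asc (RP2_braid_group n) (sigma_braid n) m"
proof -
  interpret artin_relations "RP2_braid_group n" "sigma_braid n" n by (rule artin_relations_sigma)
  show "m < n \<Longrightarrow> braid_of n (map sg [1..<Suc m]) = asc m"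
  proof (induction m)
    case 0
    then show ?case by (simp add: one_RP2_braid_group)
  next
    case (Suc m)
    have "braid_of n (map sg [1..<Suc (Suc m)])
        = braid_of n (map sg [1..<Suc m]) \<otimes>\<^bsub>RP2_braid_group n\<^esub> braid_of n [sg (Suc m)]"
      using Suc.prems by (subst braid_of_append[symmetric]) (auto simp: words_over_map)
    moreover have "braid_of n [sg (Suc m)] = sigma_braid n (Suc m)"
      using Suc.prems by (simp add: sigma_braid_def)
    ultimately show ?case using Suc by (simp del: upt_Suc)
  qed
qed

lemma braid_of_desc:
  "m < n \<Longrightarrow> braid_of n (map sg (rev [1..<Suc m])) =
    artin_relations.desc (RP2_braid_group n) (sigma_braid n) 1 m"
proof -
  interpret artin_relations "RP2_braid_group n" "sigma_braid n" n by (rule artin_relations_sigma)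
  show "m < n \<Longrightarrow> braid_of n (map sg (rev [1..<Suc m])) = desc 1 m"
  proof (induction m)
    case 0
    then show ?case by (simp add: one_RP2_braid_group)
  next
    case (Suc m)
    have "rev [1..<Suc (Suc m)] = Suc m # rev [1..<Suc m]" by simp
    then show ?case using Suc by (simp add: braid_of_Cons words_over_map del: upt_Suc)
  qed
qed

lemma van_buskirk_relations_sigma_rho:
  assumes "n \<ge> 2"
  shows "van_buskirk_relations (RP2_braid_group n) (sigma_braid n) n (rho_braid n)"
proof -
  interpret artin_relations "RP2_braid_group n" "sigma_braid n" n by (rule artin_relations_sigma)
  let ?B = "RP2_braid_group n"
  note [simp] = braid_of_Cons sigma_braid_closed rho_braid_closed one_RP2_braid_group[symmetric]
  have cancel: "sigma_braid n i \<otimes>\<^bsub>?B\<^esub> (inv\<^bsub>?B\<^esub> sigma_braid n i \<otimes>\<^bsub>?B\<^esub> x) = x" if "x \<in> carrier ?B" for i x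
    using that by (simp flip: m_assoc)
  show ?thesis
  proof
    show "n \<ge> 2" by fact
    show "rho_braid n j \<in> carrier ?B" for j by simp
    show "sigma_braid n i \<otimes>\<^bsub>?B\<^esub> rho_braid n j = rho_braid n j \<otimes>\<^bsub>?B\<^esub> sigma_braid n i"
      if "1 \<le> i" "i < n" "1 \<le> j" "j \<le> n" "j \<noteq> i" "j \<noteq> i + 1" for i j
    proof -
      have "braid_of n [sg i, rh j] = braid_of n [rh j, sg i]"
        using that by (intro braid_relation) (auto simp: braid_rels_def)
      then show ?thesis using that by simp
    qed
    show "rho_braid n i = sigma_braid n i \<otimes>\<^bsub>?B\<^esub> (rho_braid n (i + 1) \<otimes>\<^bsub>?B\<^esub> sigma_braid n i)"
      if "1 \<le> i" "i < n" for i
    proof -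
      have "braid_of n [rh (i + 1)] = braid_of n [sg_inv i, rh i, sg_inv i]"
        using that by (intro braid_relation) (auto simp: braid_rels_def)
      then have "rho_braid n (i + 1) = inv\<^bsub>?B\<^esub> sigma_braid n i \<otimes>\<^bsub>?B\<^esub> (rho_braid n i \<otimes>\<^bsub>?B\<^esub> inv\<^bsub>?B\<^esub> sigma_braid n i)"
        using that by simp
      then show ?thesis by (simp add: m_assoc cancel)
    qed
    show "rho_braid n i \<otimes>\<^bsub>?B\<^esub> (rho_braid n (i + 1) \<otimes>\<^bsub>?B\<^esub> (sigma_braid n i \<otimes>\<^bsub>?B\<^esub> sigma_braid n i)) =
        rho_braid n (i + 1) \<otimes>\<^bsub>?B\<^esub> rho_braid n i"
      if "1 \<le> i" "i < n" for i
    proof -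
      have "braid_of n [rh_inv (i + 1), rh_inv i, rh (i + 1), rh i] = braid_of n [sg i, sg i]"
        using that by (intro braid_relation) (auto simp: braid_rels_def)
      then have "inv\<^bsub>?B\<^esub> rho_braid n (i + 1) \<otimes>\<^bsub>?B\<^esub> (inv\<^bsub>?B\<^esub> rho_braid n i \<otimes>\<^bsub>?B\<^esub> (rho_braid n (i + 1) \<otimes>\<^bsub>?B\<^esub> rho_braid n i))
          = sigma_braid n i \<otimes>\<^bsub>?B\<^esub> sigma_braid n i"
        using that by simp
      then show ?thesis by (simp add: inv_solve_left')
    qed
    show "rho_braid n 1 \<otimes>\<^bsub>?B\<^esub> rho_braid n 1 = asc (n - 1) \<otimes>\<^bsub>?B\<^esub> desc 1 (n - 1)"
    proof -
      have "braid_of n [rh 1, rh 1] = braid_of n (map sg [1..<n] @ map sg (rev [1..<n]))"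
        using assms by (intro braid_relation) (auto simp: braid_rels_def words_over_map)
      also have "\<dots> = braid_of n (map sg [1..<n]) \<otimes>\<^bsub>?B\<^esub> braid_of n (map sg (rev [1..<n]))"
        by (rule braid_of_append) (auto simp: words_over_map)
      also have "\<dots> = asc (n - 1) \<otimes>\<^bsub>?B\<^esub> desc 1 (n - 1)"
        using braid_of_asc[of "n - 1" n] braid_of_desc[of "n - 1" n] assms by simp
      finally show ?thesis using assms by simp
    qed
  qed
qed

lemma braid_group_generated:
  "carrier (RP2_braid_group n) =
    generate (RP2_braid_group n) (sigma_braid n ` {1..n - 1} \<union> rho_braid n ` {1..n})"
    (is "_ = generate _ ?E")
proof
  interpret group "RP2_braid_group n" by (rule group_RP2_braid_group)
  have E: "?E \<subseteq> carrier (RP2_braid_group n)" using sigma_braid_closed rho_braid_closed by auto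
  then show "generate (RP2_braid_group n) ?E \<subseteq> carrier (RP2_braid_group n)" by (rule generate_incl)
  have letters: "braid_letter n x \<in> generate (RP2_braid_group n) ?E" if "fst x \<in> braid_gens n" for x
    using that by (cases "(n, x)" rule: braid_letter.cases) (auto intro: generate.incl generate.inv)
  have "braid_of n w \<in> generate (RP2_braid_group n) ?E" if "w \<in> words_over (braid_gens n)" for w
    using that
  proof (induction w)
    case Nil
    then show ?case using generate.one by (simp flip: one_RP2_braid_group)
  next
    case (Cons x w)
    then have "braid_of n (x # w) = braid_letter n x \<otimes>\<^bsub>RP2_braid_group n\<^esub> braid_of n w"
      by (intro braid_of_Cons) simp_all
    then show ?case using Cons generate.eng by (metis words_over_simps(2) letters)
  qed
  then show "carrier (RP2_braid_group n) \<subseteq> generate (RP2_braid_group n) ?E"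
    by (auto simp: carrier_RP2_braid_group)
qed

lemma full_twist_eq:
  "n \<ge> 1 \<Longrightarrow> full_twist n = artin_relations.asc (RP2_braid_group n) (sigma_braid n) (n - 1) [^]\<^bsub>RP2_braid_group n\<^esub> n"
proof -
  assume n: "n \<ge> 1"
  interpret artin_relations "RP2_braid_group n" "sigma_braid n" n by (rule artin_relations_sigma)
  let ?g = "map sg [1..<n]"
  have g: "?g \<in> words_over (braid_gens n)" by (auto simp: words_over_map)
  have w: "concat (replicate k ?g) \<in> words_over (braid_gens n)" for k
    using g by (induction k) auto
  have "braid_of n (concat (replicate k ?g)) = asc (n - 1) [^]\<^bsub>RP2_braid_group n\<^esub> k" for k
  proof (induction k)
    case 0
    then show ?case by (simp add: one_RP2_braid_group)
  next
    case (Suc k)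
    have "braid_of n (concat (replicate (Suc k) ?g))
        = asc (n - 1) \<otimes>\<^bsub>RP2_braid_group n\<^esub> braid_of n (concat (replicate k ?g))"
      using braid_of_append[OF g w[of k]] braid_of_asc[of "n - 1" n] n by simp
    then show ?case unfolding Suc by (simp only: nat_pow_Suc2 asc_closed)
  qed
  then show ?thesis by (simp add: full_twist_def)
qed

lemma braid_a_eq: "n \<ge> 2 \<Longrightarrow> braid_a n = van_buskirk_relations.rot (RP2_braid_group n) (sigma_braid n) (rho_braid n) n"
  and braid_b_eq:
    "n \<ge> 2 \<Longrightarrow> braid_b n = van_buskirk_relations.rot (RP2_braid_group n) (sigma_braid n) (rho_braid n) (n - 1)"
proof -
  assume n: "n \<ge> 2"
  then interpret van_buskirk_relations "RP2_braid_group n" "sigma_braid n" n "rho_braid n"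
    by (rule van_buskirk_relations_sigma_rho)
  show "braid_a n = rot n"
    using n braid_of_desc[of "n - 1" n]
    by (simp add: braid_a_def rot_def braid_of_Cons words_over_map)
  obtain m where m: "n - 1 = Suc m" "m < n" using n by (cases "n - 1") auto
  show "braid_b n = rot (n - 1)"
    using braid_of_desc[of m n] m
    by (simp add: braid_b_def rot_def braid_of_Cons words_over_map del: upt_Suc)
qed

lemma rho_pure: "braid_perm (rho_braid n j) = id"
  and sigma_perm: "\<lbrakk>1 \<le> i; i < n\<rbrakk> \<Longrightarrow> braid_perm (sigma_braid n i) = Transposition.transpose i (i + 1)"
proof -
  show "braid_perm (rho_braid n j) = id"
    by (auto simp: rho_braid_def one_RP2_braid_group braid_perm_braid_of word_perm_def)
  show "\<lbrakk>1 \<le> i; i < n\<rbrakk> \<Longrightarrow> braid_perm (sigma_braid n i) = Transposition.transpose i (i + 1)"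
    by (simp add: sigma_braid_def braid_perm_braid_of word_perm_def)
qed

section \<open>Signs of pure braids\<close>

text \<open>\<open>word_flip w k\<close> records whether the \<open>k\<close>-th strand of \<open>w\<close> meets an odd number of letters
\<open>\<rho>\<close>, where the strand is followed through the permutation of the letters to the right. It is the sign
part of the homomorphism to signed permutations that maps \<open>\<sigma>\<^sub>i\<close> to the transposition \<open>(i, i + 1)\<close>
and \<open>\<rho>\<^sub>j\<close> to the change of sign at \<open>j\<close>.\<close>

fun letter_flip :: "braid_gen \<times> bool \<Rightarrow> nat \<Rightarrow> bool" where
  "letter_flip (BSigma i, e) k = False"
| "letter_flip (BRho j, e) k = (k = j)"

primrec word_flip :: "braid_gen word \<Rightarrow> nat \<Rightarrow> bool" where
  "word_flip [] k = False"
| "word_flip (x # w) k = (letter_flip x (word_perm w k) \<noteq> word_flip w k)"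

lemma word_flip_append: "word_flip (u @ v) k = (word_flip u (word_perm v k) \<noteq> word_flip v k)"
  by (induction u) (auto simp: word_perm_append)

lemma word_flip_map_sg: "\<not> word_flip (map sg w) k"
  by (induction w) auto

lemma word_flip_cong:
  "word_cong (braid_gens n) (braid_rels n) u v \<Longrightarrow> word_flip u k = word_flip v k"
proof (induction arbitrary: k rule: word_cong.induct)
  case (rel u v)
  then show ?case
    unfolding braid_rels_def
  proof (elim UnE)
    assume "(u, v) \<in> {([rh 1, rh 1], map sg [1..<n] @ map sg (rev [1..<n]))}"
    then show ?thesis
      using word_flip_map_sg[of "[1..<n] @ rev [1..<n]"] by (auto simp: word_perm_def)
  qed (auto simp: word_perm_def Transposition.transpose_def split: if_splits)
next
  case (cancel g e)
  then show ?case by (cases g) (auto simp: word_perm_def)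
next
  case (append u u' v v')
  then show ?case by (simp add: word_flip_append word_perm_cong[OF append.hyps(2)])
qed auto

text \<open>All words in a braid have the same signs by the preceding lemma, so \<open>the_elem\<close> picks the common value.\<close>

definition braid_flips :: "nat \<Rightarrow> braid_gen word set \<Rightarrow> nat set" where
  "braid_flips n A = {k \<in> {1..n}. the_elem ((\<lambda>w. word_flip w k) ` A)}"

lemma braid_flips_braid_of:
  assumes "w \<in> words_over (braid_gens n)"
  shows "braid_flips n (braid_of n w) = {k \<in> {1..n}. word_flip w k}"
proof -
  have "braid_of n w \<noteq> {}"
    using assms by (auto simp: braid_of_def word_class_def intro: word_cong.refl)
  moreover have "word_flip v k = word_flip w k" if "v \<in> braid_of n w" for v k
    using that word_flip_cong[of n w v k] by (simp add: braid_of_def word_class_def)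
  ultimately have "the_elem ((\<lambda>w. word_flip w k) ` braid_of n w) = word_flip w k" for k
    by (rule the_elem_image_unique)
  then show ?thesis by (simp add: braid_flips_def)
qed

lemma RP2_pure_braids_iff:
  "w \<in> words_over (braid_gens n) \<Longrightarrow> braid_of n w \<in> RP2_pure_braids n \<longleftrightarrow> word_perm w = id"
  by (simp add: RP2_pure_braids_def kernel_def sym_group_one braid_of_closed braid_perm_braid_of)

text \<open>On pure braids the permutation is trivial and the cocycle rule for signs becomes additivity.\<close>

lemma braid_flips_hom:
  "braid_flips n \<in> hom ((RP2_braid_group n)\<lparr>carrier := RP2_pure_braids n\<rparr>) (symdiff_group {1..n})"
proof (rule homI)
  fix x y
  assume "x \<in> carrier ((RP2_braid_group n)\<lparr>carrier := RP2_pure_braids n\<rparr>)"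
    and y: "y \<in> carrier ((RP2_braid_group n)\<lparr>carrier := RP2_pure_braids n\<rparr>)"
  then obtain u v where uv: "u \<in> words_over (braid_gens n)" "x = braid_of n u"
      "v \<in> words_over (braid_gens n)" "y = braid_of n v"
    by (auto simp: RP2_pure_braids_def kernel_def carrier_RP2_braid_group)
  then have "word_perm v = id" using y by (simp add: RP2_pure_braids_iff)
  then show "braid_flips n (x \<otimes>\<^bsub>(RP2_braid_group n)\<lparr>carrier := RP2_pure_braids n\<rparr>\<^esub> y) =
      braid_flips n x \<otimes>\<^bsub>symdiff_group {1..n}\<^esub> braid_flips n y"
    using uv
    by (auto simp: braid_flips_braid_of word_flip_append symdiff_group_def simp flip: braid_of_append)
qed (auto simp: symdiff_group_def braid_flips_def)

lemma word_perm_map_rh: "word_perm (map rh js) = id"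
  by (induction js) (auto simp: word_perm_def)

lemma word_flip_map_rh: "distinct js \<Longrightarrow> word_flip (map rh js) k \<longleftrightarrow> k \<in> set js"
  by (induction js) (auto simp: word_perm_map_rh)

lemma braid_flips_onto: "braid_flips n ` RP2_pure_braids n = Pow {1..n}"
proof
  show "Pow {1..n} \<subseteq> braid_flips n ` RP2_pure_braids n"
  proof
    fix A assume A: "A \<in> Pow {1..n}"
    then have "finite A" by (auto intro: finite_subset)
    then obtain js where js: "set js = A" "distinct js" using finite_distinct_list by blast
    then have w: "map rh js \<in> words_over (braid_gens n)" using A by (auto simp: words_over_map)
    then have "braid_flips n (braid_of n (map rh js)) = A"
      using A js by (auto simp: braid_flips_braid_of word_flip_map_rh)
    then show "A \<in> braid_flips n ` RP2_pure_braids n"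
      using w by (force simp: RP2_pure_braids_iff word_perm_map_rh)
  qed
qed (auto simp: braid_flips_def)

lemma braid_flips_full_twist: "braid_flips n (full_twist n) = {}"
proof -
  let ?w = "concat (replicate n (map sg [1..<n]))"
  have "?w = map sg (concat (replicate n [1..<n]))" by (simp add: map_concat)
  moreover have "?w \<in> words_over (braid_gens n)"
    unfolding calculation by (auto simp: words_over_map)
  ultimately show ?thesis
    by (simp add: full_twist_def braid_flips_braid_of word_flip_map_sg)
qed

section \<open>Isotopy is an equivalence relation\<close>

text \<open>An isotopy relative to \<open>X\<close> is a homotopy through homeomorphisms that agree with \<open>f\<close> on \<open>X\<close>. Symmetry
and transitivity are then inherited from homotopies, once the reference map \<open>f\<close> may be exchanged for
an isotopic one.\<close>

lemma RP2_isotopic_iff_homotopic_with: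
  assumes "X \<subseteq> topspace RP2"
  shows "RP2_isotopic X f g \<longleftrightarrow>
    homotopic_with (\<lambda>k. homeomorphic_map RP2 RP2 k \<and> (\<forall>x\<in>X. k x = f x)) RP2 RP2 f g"
proof -
  let ?P = "\<lambda>k. homeomorphic_map RP2 RP2 k \<and> (\<forall>x\<in>X. k x = f x)"
  have P: "?P h \<longleftrightarrow> ?P k" if hk: "\<And>x. x \<in> topspace RP2 \<Longrightarrow> h x = k x" for h k
  proof -
    have "homeomorphic_map RP2 RP2 h \<longleftrightarrow> homeomorphic_map RP2 RP2 k"
      using homeomorphic_map_eq[of RP2 RP2 h k] homeomorphic_map_eq[of RP2 RP2 k h] hk by force
    moreover have "h x = k x" if "x \<in> X" for x using hk assms that by blast
    ultimately show ?thesis by simp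
  qed
  let ?Q = "\<lambda>h :: real \<times> (real^3) set \<Rightarrow> (real^3) set.
     continuous_map (prod_topology (top_of_set {0..1}) RP2) RP2 h \<and>
     (\<forall>x\<in>topspace RP2. h (0, x) = f x) \<and> (\<forall>x\<in>topspace RP2. h (1, x) = g x) \<and>
     (\<forall>t\<in>{0..1}. ?P (\<lambda>x. h (t, x)))"
  have "RP2_isotopic X f g \<longleftrightarrow> Ex ?Q"
  proof
    assume "RP2_isotopic X f g"
    then obtain H where H:
      "continuous_map (prod_topology (top_of_set {0..1::real}) RP2) RP2 (\<lambda>(t, x). H t x)"
      "\<And>t. t \<in> {0..1} \<Longrightarrow> homeomorphic_map RP2 RP2 (H t)"
      "\<And>t x. t \<in> {0..1} \<Longrightarrow> x \<in> X \<Longrightarrow> H t x = H 0 x"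
      "\<And>x. x \<in> topspace RP2 \<Longrightarrow> H 0 x = f x" "\<And>x. x \<in> topspace RP2 \<Longrightarrow> H 1 x = g x"
      unfolding RP2_isotopic_def by blast
    have "H t x = f x" if "t \<in> {0..1}" "x \<in> X" for t x
      using H(3)[OF that] H(4)[of x] assms that(2) by (simp add: subset_iff)
    then have "?Q (\<lambda>(t, x). H t x)"
      using H(1,2,4,5) by (intro conjI ballI) (simp_all only: prod.case)
    then show "Ex ?Q" by (rule exI[of ?Q])
  next
    assume "Ex ?Q"
    then obtain h where h: "?Q h" ..
    have eq: "(\<lambda>(t, x). h (t, x)) = h" by (simp add: fun_eq_iff)
    have "h (t, x) = h (0, x)" if "t \<in> {0..1}" "x \<in> X" for t x
      using h that by simp
    then show "RP2_isotopic X f g"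
      unfolding RP2_isotopic_def using h
      by (intro exI[of _ "\<lambda>t x. h (t, x)"] conjI ballI) (simp_all only: eq)
  qed
  also have "\<dots> \<longleftrightarrow> homotopic_with ?P RP2 RP2 f g"
    by (rule homotopic_with[OF P, symmetric])
  finally show ?thesis .
qed

lemma RP2_isotopic_imp_eq_on:
  assumes "X \<subseteq> topspace RP2" "RP2_isotopic X f g" "x \<in> X"
  shows "g x = f x"
  using homotopic_with_imp_property[of _ RP2 RP2 f g] assms
  by (auto simp: RP2_isotopic_iff_homotopic_with)

lemma RP2_isotopic_cong_base:
  assumes "X \<subseteq> topspace RP2" "RP2_isotopic X f g"
  shows "homotopic_with (\<lambda>k. homeomorphic_map RP2 RP2 k \<and> (\<forall>x\<in>X. k x = g x)) RP2 RP2 f g"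
  using assms RP2_isotopic_imp_eq_on[OF assms]
  by (auto simp: RP2_isotopic_iff_homotopic_with elim!: homotopic_with_mono)

lemma RP2_isotopic_refl:
  assumes "X \<subseteq> topspace RP2" "f \<in> RP2_homeos X"
  shows "RP2_isotopic X f f"
  using assms by (simp add: RP2_isotopic_iff_homotopic_with RP2_homeos_def homeomorphic_imp_continuous_map)

lemma RP2_isotopic_sym:
  assumes "X \<subseteq> topspace RP2" "RP2_isotopic X f g"
  shows "RP2_isotopic X g f"
  using RP2_isotopic_cong_base[OF assms] assms(1)
  by (simp add: RP2_isotopic_iff_homotopic_with homotopic_with_symD)

lemma RP2_isotopic_trans:
  assumes "X \<subseteq> topspace RP2" "RP2_isotopic X f g" "RP2_isotopic X g h"
  shows "RP2_isotopic X f h"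
proof -
  have "homotopic_with (\<lambda>k. homeomorphic_map RP2 RP2 k \<and> (\<forall>x\<in>X. k x = g x)) RP2 RP2 f h"
    using RP2_isotopic_cong_base[OF assms(1,2)] assms(1,3)
    by (auto simp: RP2_isotopic_iff_homotopic_with intro: homotopic_with_trans)
  then show ?thesis
    using RP2_isotopic_imp_eq_on[OF assms(1,2)] assms(1)
    by (auto simp: RP2_isotopic_iff_homotopic_with elim!: homotopic_with_mono)
qed

lemma isotopy_class_eq:
  assumes "X \<subseteq> topspace RP2" "RP2_isotopic X f g"
  shows "isotopy_class X f = isotopy_class X g"
  using RP2_isotopic_trans[OF assms(1)] RP2_isotopic_sym[OF assms(1)] assms(2)
  unfolding isotopy_class_def by blast

lemma identity_in_RP2_homeos: "X \<subseteq> topspace RP2 \<Longrightarrow> (\<lambda>x\<in>topspace RP2. x) \<in> RP2_homeos X"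
proof -
  assume X: "X \<subseteq> topspace RP2"
  have "homeomorphic_map RP2 RP2 (\<lambda>x\<in>topspace RP2. x)"
    using homeomorphic_map_eq[of RP2 RP2 id] by (simp add: homeomorphic_map_id)
  moreover have "(\<lambda>x\<in>topspace RP2. x) ` X = X" using X by (force simp: restrict_def image_def)
  ultimately show ?thesis by (simp add: RP2_homeos_def)
qed

text \<open>A bijection that preserves products need not preserve a neutral element that is given separately.
Let the image of the neutral element be the class of \<open>e\<close>. The product of this class with the class of the
identity is the latter, and it contains \<open>e\<close>. Hence \<open>e\<close> is isotopic to the identity.\<close>

lemma iso_one_MCG:
  assumes "group G" and \<phi>: "\<phi> \<in> iso G (MCG X)" and X: "X \<subseteq> topspace RP2"
  shows "\<phi> \<one>\<^bsub>G\<^esub> = \<one>\<^bsub>MCG X\<^esub>"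
proof -
  interpret group G by fact
  let ?I = "\<lambda>x\<in>topspace RP2. x"
  have I: "?I \<in> RP2_homeos X" by (rule identity_in_RP2_homeos[OF X])
  have img: "\<phi> ` carrier G = isotopy_class X ` RP2_homeos X" and hom: "\<phi> \<in> hom G (MCG X)"
    using \<phi> by (auto simp: iso_def bij_betw_def MCG_def)
  then have "\<phi> \<one>\<^bsub>G\<^esub> \<in> isotopy_class X ` RP2_homeos X" by auto
  then obtain e where e: "e \<in> RP2_homeos X" "\<phi> \<one>\<^bsub>G\<^esub> = isotopy_class X e" by blast
  have "isotopy_class X ?I \<in> \<phi> ` carrier G" using img I by blast
  then obtain y where y: "y \<in> carrier G" "isotopy_class X ?I = \<phi> y" by blast
  have "isotopy_class X e \<otimes>\<^bsub>MCG X\<^esub> isotopy_class X ?I = isotopy_class X ?I"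
    using hom_mult[OF hom one_closed y(1)] y e by simp
  moreover have "compose (topspace RP2) e ?I = e"
    using e(1) by (intro ext) (simp add: compose_def RP2_homeos_def extensional_def)
  moreover have "e \<in> isotopy_class X e" "?I \<in> isotopy_class X ?I"
    using e(1) I RP2_isotopic_refl[OF X] by (auto simp: isotopy_class_def)
  ultimately have "e \<in> isotopy_class X ?I" by (force simp: MCG_def)
  then have "RP2_isotopic X ?I e" by (simp add: isotopy_class_def)
  then have "isotopy_class X ?I = isotopy_class X e" by (rule isotopy_class_eq[OF X])
  then show ?thesis using e by (simp add: MCG_def)
qed

section \<open>The pure mapping class group\<close>

definition torsion_elements :: "nat \<Rightarrow> braid_gen word set set" where
  "torsion_elements n = insert (braid_a n [^]\<^bsub>RP2_braid_group n\<^esub> n)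
     {braid_a n [^]\<^bsub>RP2_braid_group n\<^esub> k \<otimes>\<^bsub>RP2_braid_group n\<^esub>
        braid_b n [^]\<^bsub>RP2_braid_group n\<^esub> (n - 1) \<otimes>\<^bsub>RP2_braid_group n\<^esub>
        inv\<^bsub>RP2_braid_group n\<^esub> (braid_a n [^]\<^bsub>RP2_braid_group n\<^esub> k) | k. k \<le> n - 2}"

text \<open>Every square is \<open>a\<^sup>2\<^sup>n\<close>, the inverse of the full twist, so the elements of this set have square one in
the quotient. The full twist generates a normal subgroup because it commutes with all generators.\<close>

lemma pure_braids_torsion_generated:
  assumes "n \<ge> 2"
  shows "RP2_pure_braids n = generate (RP2_braid_group n) (torsion_elements n)"
    and "torsion_elements n \<subseteq> RP2_pure_braids n"
    and "finite (torsion_elements n)" "card (torsion_elements n) \<le> n"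
    and "\<And>t. t \<in> torsion_elements n \<Longrightarrow>
      t \<otimes>\<^bsub>RP2_braid_group n\<^esub> t = inv\<^bsub>RP2_braid_group n\<^esub> full_twist n"
    and "full_twist n \<in> RP2_pure_braids n"
    and "full_twist_subgroup n \<lhd> RP2_braid_group n"
    and "braid_a n \<in> carrier (RP2_braid_group n)" "braid_b n \<in> carrier (RP2_braid_group n)"
proof -
  let ?B = "RP2_braid_group n"
  interpret van_buskirk_relations ?B "sigma_braid n" n "rho_braid n"
    by (rule van_buskirk_relations_sigma_rho[OF assms])
  have T: "torsion_elements n = insert (rot n [^]\<^bsub>?B\<^esub> n) (rot_conj ` {0..n - 2})"
    using assms by (auto simp: torsion_elements_def rot_conj_def braid_a_eq braid_b_eq)
  have pure: "RP2_pure_braids n = generate ?B (rho_braid n ` {1..n})"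
    unfolding RP2_pure_braids_def
    by (rule pure_subgroup_generated[OF braid_group_generated braid_perm_hom sigma_perm rho_pure])
  then show gen: "RP2_pure_braids n = generate ?B (torsion_elements n)"
    using generate_rot_powers by (simp only: T)
  then show sub: "torsion_elements n \<subseteq> RP2_pure_braids n"
    by (auto intro: generate.incl)
  show "finite (torsion_elements n)" by (simp add: T)
  have "card (torsion_elements n) \<le> Suc (card (rot_conj ` {0..n - 2}))"
    unfolding T by (rule card_insert_le_m1) simp_all
  also have "card (rot_conj ` {0..n - 2}) \<le> card {0..n - 2}" by (rule card_image_le) simp
  finally show "card (torsion_elements n) \<le> n" using assms by simp
  have twist: "full_twist n = inv\<^bsub>?B\<^esub> (rot n [^]\<^bsub>?B\<^esub> n \<otimes>\<^bsub>?B\<^esub> rot n [^]\<^bsub>?B\<^esub> n)"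
    using assms by (simp only: full_twist_eq asc_pow_eq)
  show "t \<otimes>\<^bsub>?B\<^esub> t = inv\<^bsub>?B\<^esub> full_twist n" if "t \<in> torsion_elements n" for t
    using that by (auto simp: T twist rot_conj_square)
  have P: "subgroup (RP2_pure_braids n) ?B"
    unfolding pure by (rule generate_is_subgroup) auto
  show "full_twist n \<in> RP2_pure_braids n"
    unfolding twist using sub T subgroup.m_closed[OF P] subgroup.m_inv_closed[OF P] by auto
  show "full_twist_subgroup n \<lhd> ?B"
    unfolding full_twist_subgroup_def
  proof (rule normal_generateI_generators[OF _ _ braid_group_generated])
    fix e y assume e: "e \<in> sigma_braid n ` {1..n - 1} \<union> rho_braid n ` {1..n}" and "y \<in> {full_twist n}"
    then have y: "y = full_twist n" "y \<in> carrier ?B" by (auto simp: twist)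
    have ec: "e \<in> carrier ?B" using e by auto
    have c: "e \<otimes>\<^bsub>?B\<^esub> y = y \<otimes>\<^bsub>?B\<^esub> e"
      using full_twist_commutes[OF e] y(1) full_twist_eq assms by simp
    have "e \<otimes>\<^bsub>?B\<^esub> y \<otimes>\<^bsub>?B\<^esub> inv\<^bsub>?B\<^esub> e = y"
      unfolding c using ec y(2) by (simp add: m_assoc)
    moreover have "inv\<^bsub>?B\<^esub> e \<otimes>\<^bsub>?B\<^esub> y \<otimes>\<^bsub>?B\<^esub> e = y"
      using ec y(2) by (simp add: m_assoc flip: c) (simp flip: m_assoc)
    ultimately show "e \<otimes>\<^bsub>?B\<^esub> y \<otimes>\<^bsub>?B\<^esub> inv\<^bsub>?B\<^esub> e \<in> generate ?B {full_twist n}"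
      "inv\<^bsub>?B\<^esub> e \<otimes>\<^bsub>?B\<^esub> y \<otimes>\<^bsub>?B\<^esub> e \<in> generate ?B {full_twist n}"
      using y(1) by (auto intro: generate.incl)
  qed (auto simp: twist)
  show "braid_a n \<in> carrier ?B" "braid_b n \<in> carrier ?B"
    using assms by (simp_all add: braid_a_eq braid_b_eq)
qed

text \<open>Powers and inverses may be taken before passing to the quotient by the full twist.\<close>

lemma torsion_set_eq_image:
  assumes "n \<ge> 2"
  shows "insert (MCG_image n (braid_a n) [^]\<^bsub>braid_MCG n\<^esub> n)
      {MCG_image n (braid_a n) [^]\<^bsub>braid_MCG n\<^esub> k \<otimes>\<^bsub>braid_MCG n\<^esub>
        MCG_image n (braid_b n) [^]\<^bsub>braid_MCG n\<^esub> (n - 1) \<otimes>\<^bsub>braid_MCG n\<^esub>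
        inv\<^bsub>braid_MCG n\<^esub> (MCG_image n (braid_a n) [^]\<^bsub>braid_MCG n\<^esub> k) | k. k \<le> n - 2}
    = MCG_image n ` torsion_elements n"
proof -
  let ?B = "RP2_braid_group n" and ?M = "braid_MCG n"
  interpret B: group ?B by (rule group_RP2_braid_group)
  interpret K: normal "full_twist_subgroup n" ?B by (rule pure_braids_torsion_generated(7)[OF assms])
  have M: "?M = ?B Mod full_twist_subgroup n" by (simp add: braid_MCG_def)
  have q: "MCG_image n = (\<lambda>x. full_twist_subgroup n #>\<^bsub>?B\<^esub> x)"
    by (simp add: MCG_image_def fun_eq_iff)
  have "group ?M" unfolding M by (rule K.factorgroup_is_group)
  moreover have "MCG_image n \<in> hom ?B ?M" unfolding M q by (rule K.r_coset_hom_Mod)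
  ultimately interpret q: group_hom ?B ?M "MCG_image n"
    by (intro group_hom.intro group_hom_axioms.intro B.is_group)
  note ab = pure_braids_torsion_generated(8,9)[OF assms]
  have pow: "MCG_image n (x [^]\<^bsub>?B\<^esub> k) = MCG_image n x [^]\<^bsub>?M\<^esub> k" if "x \<in> carrier ?B"
    for x and k :: nat
    unfolding M q by (rule K.FactGroup_pow[OF that, symmetric])
  have conj: "MCG_image n (braid_a n [^]\<^bsub>?B\<^esub> k \<otimes>\<^bsub>?B\<^esub> braid_b n [^]\<^bsub>?B\<^esub> (n - 1)
        \<otimes>\<^bsub>?B\<^esub> inv\<^bsub>?B\<^esub> (braid_a n [^]\<^bsub>?B\<^esub> k))
    = MCG_image n (braid_a n) [^]\<^bsub>?M\<^esub> k \<otimes>\<^bsub>?M\<^esub> MCG_image n (braid_b n) [^]\<^bsub>?M\<^esub> (n - 1)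
        \<otimes>\<^bsub>?M\<^esub> inv\<^bsub>?M\<^esub> (MCG_image n (braid_a n) [^]\<^bsub>?M\<^esub> k)" for k :: nat
    using ab by (simp add: pow)
  show ?thesis
    unfolding torsion_elements_def image_insert setcompr_eq_image image_image conj pow[OF ab(1)] ..
qed

text \<open>The pure braids pass to the quotient by the full twist: the squares \<open>a\<^sup>2\<^sup>n\<close> and \<open>b\<^sup>2\<^sup>(\<^sup>n\<^sup>-\<^sup>1\<^sup>)\<close> become
trivial, and the signs survive because the full twist contains no letter \<open>\<rho>\<close>.\<close>

lemma braid_PMCG_torsion_generated:
  assumes "n \<ge> 2"
  shows "group (braid_PMCG n)"
    and "generated_by (braid_PMCG n) (MCG_image n ` torsion_elements n)"
    and "\<And>t. t \<in> MCG_image n ` torsion_elements n \<Longrightarrow>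
      t \<otimes>\<^bsub>braid_PMCG n\<^esub> t = \<one>\<^bsub>braid_PMCG n\<^esub>"
    and "\<exists>h. h \<in> hom (braid_PMCG n) (symdiff_group {1..n}) \<and> h ` carrier (braid_PMCG n) = Pow {1..n}"
proof -
  let ?B = "RP2_braid_group n" and ?P = "RP2_pure_braids n" and ?K = "full_twist_subgroup n"
  let ?B' = "?B\<lparr>carrier := ?P\<rparr>" and ?T = "torsion_elements n"
  note facts = pure_braids_torsion_generated[OF assms]
  interpret B: group ?B by (rule group_RP2_braid_group)
  have TB: "?T \<subseteq> carrier ?B"
    using facts(2) by (auto simp: RP2_pure_braids_def kernel_def)
  have P: "subgroup ?P ?B" using TB by (simp add: facts(1) B.generate_is_subgroup)
  have KP: "?K \<subseteq> ?P"
    unfolding full_twist_subgroup_def using facts(6) by (intro B.generate_subgroup_incl[OF _ P]) simp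
  interpret B': group ?B' by (rule subgroup.subgroup_is_group[OF P B.is_group])
  interpret K: normal ?K ?B' by (rule B.normal_restrict_supergroup[OF P facts(7) KP])
  have PM: "braid_PMCG n = ?B' Mod ?K" by (simp add: braid_PMCG_def)
  show grp: "group (braid_PMCG n)" unfolding PM by (rule K.factorgroup_is_group)
  interpret Q: group "braid_PMCG n" by (rule grp)
  have q: "MCG_image n = (\<lambda>x. ?K #>\<^bsub>?B'\<^esub> x)" by (simp add: MCG_image_def r_coset_def fun_eq_iff)
  have "MCG_image n \<in> hom ?B' (braid_PMCG n)" unfolding PM q by (rule K.r_coset_hom_Mod)
  then interpret q: group_hom ?B' "braid_PMCG n" "MCG_image n"
    by (intro group_hom.intro group_hom_axioms.intro B'.is_group grp)
  have "generate (braid_PMCG n) (MCG_image n ` ?T) = MCG_image n ` generate ?B' ?T"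
    using facts(2) by (intro q.generate_img) simp
  also have "generate ?B' ?T = ?P" using B.generate_consistent[OF facts(2) P] facts(1) by simp
  also have img: "MCG_image n ` ?P = carrier (braid_PMCG n)"
    unfolding PM q by (simp add: carrier_FactGroup)
  finally show "generated_by (braid_PMCG n) (MCG_image n ` ?T)"
    using facts(2) img by (auto simp: generated_by_def)
  show "t \<otimes>\<^bsub>braid_PMCG n\<^esub> t = \<one>\<^bsub>braid_PMCG n\<^esub>" if t: "t \<in> MCG_image n ` ?T" for t
  proof -
    obtain u where u: "u \<in> ?T" "t = MCG_image n u" using t by blast
    have uP: "u \<in> carrier ?B'" using u facts(2) by auto
    have "u \<otimes>\<^bsub>?B'\<^esub> u = inv\<^bsub>?B\<^esub> full_twist n" using facts(5)[OF u(1)] by simp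
    also have "\<dots> \<in> ?K" unfolding full_twist_subgroup_def by (rule generate.inv) simp
    finally have uu: "u \<otimes>\<^bsub>?B'\<^esub> u \<in> ?K" .
    have "t \<otimes>\<^bsub>braid_PMCG n\<^esub> t = MCG_image n (u \<otimes>\<^bsub>?B'\<^esub> u)"
      using q.hom_mult[OF uP uP] u(2) by simp
    also have "\<dots> = ?K"
      unfolding q by (rule B'.coset_join2[OF B'.m_closed[OF uP uP] K.subgroup_axioms uu])
    finally show ?thesis by (simp add: PM)
  qed
  have E: "group (symdiff_group {1..n})"
    using comm_group_symdiff_group by (rule comm_group.axioms(2))
  interpret f: group_hom ?B' "symdiff_group {1..n}" "braid_flips n"
    by (intro group_hom.intro group_hom_axioms.intro B'.is_group E braid_flips_hom)
  have "full_twist n \<in> kernel ?B' (symdiff_group {1..n}) (braid_flips n)"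
    using facts(6) braid_flips_full_twist by (simp add: kernel_def symdiff_group_def)
  then have "generate ?B' {full_twist n} \<subseteq> kernel ?B' (symdiff_group {1..n}) (braid_flips n)"
    by (intro B'.generate_subgroup_incl f.subgroup_kernel) simp
  moreover have "generate ?B' {full_twist n} = ?K"
    unfolding full_twist_subgroup_def using facts(6) by (intro B.generate_consistent P) simp
  ultimately have "braid_flips n k = \<one>\<^bsub>symdiff_group {1..n}\<^esub>" if "k \<in> ?K" for k
    using that by (auto simp: kernel_def)
  then obtain h where h: "h \<in> hom (?B' Mod ?K) (symdiff_group {1..n})"
      "\<And>x. x \<in> carrier ?B' \<Longrightarrow> h (?K #>\<^bsub>?B'\<^esub> x) = braid_flips n x"
    using hom_FactGroup_factor[OF braid_flips_hom E K.normal_axioms] by blast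
  have "h ` carrier (braid_PMCG n) = braid_flips n ` ?P"
    unfolding img[symmetric] image_image q using h(2) by (intro image_cong) auto
  then show "\<exists>h. h \<in> hom (braid_PMCG n) (symdiff_group {1..n}) \<and> h ` carrier (braid_PMCG n) = Pow {1..n}"
    using h(1) braid_flips_onto by (auto simp: PM)
qed

theorem proposition17:
  fixes n :: nat
  assumes "n \<ge> 2"
  shows
    "let M = braid_MCG n;
         P = braid_PMCG n;
         a = MCG_image n (braid_a n);
         b = MCG_image n (braid_b n);
         T = insert (a [^]\<^bsub>M\<^esub> n)
               {a [^]\<^bsub>M\<^esub> k \<otimes>\<^bsub>M\<^esub> b [^]\<^bsub>M\<^esub> (n - 1) \<otimes>\<^bsub>M\<^esub> inv\<^bsub>M\<^esub> (a [^]\<^bsub>M\<^esub> k) | k. k \<le> n - 2}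
     in (torsion_generated_by P T \<and>
         (\<forall>x\<in>T. group.ord P x = 2) \<and>
         G_rank P = enat n \<and> NG_rank P = enat n \<and> TG_rank P = enat n \<and> NTG_rank P = enat n \<and>
         (\<forall>Y. finite Y \<and> card Y < n \<longrightarrow> \<not> normally_generated_by P Y))
      \<and> (\<forall>X \<phi>. X \<subseteq> topspace RP2 \<and> card X = n \<and> MCG_identification n X \<phi> \<longrightarrow>
           torsion_generated_by (PMCG X) (\<phi> ` T) \<and>
           (\<forall>x\<in>\<phi> ` T. group.ord (PMCG X) x = 2) \<and>
           G_rank (PMCG X) = enat n \<and> NG_rank (PMCG X) = enat n \<and>
           TG_rank (PMCG X) = enat n \<and> NTG_rank (PMCG X) = enat n \<and>
           (\<forall>Y. finite Y \<and> card Y < n \<longrightarrow> \<not> normally_generated_by (PMCG X) Y))"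
proof -
  let ?P = "braid_PMCG n" and ?T = "MCG_image n ` torsion_elements n"
  note facts = braid_PMCG_torsion_generated[OF assms]
  interpret P: group ?P by (rule facts(1))
  obtain h where h: "h \<in> hom ?P (symdiff_group {1..n})" "h ` carrier ?P = Pow {1..n}"
    using facts(4) by blast
  have fin: "finite ?T" using pure_braids_torsion_generated(3)[OF assms] by simp
  have card: "card ?T \<le> n"
    using card_image_le[OF pure_braids_torsion_generated(3)[OF assms], of "MCG_image n"]
      pure_braids_torsion_generated(4)[OF assms] by (rule order_trans)
  have TP: "?T \<subseteq> carrier ?P" using facts(2) by (simp add: generated_by_def)
  have genP: "generate ?P ?T = carrier ?P" using facts(2) by (simp add: generated_by_def)
  have M: "group (braid_MCG n)"
    unfolding braid_MCG_def by (rule normal.factorgroup_is_group[OF pure_braids_torsion_generated(7)[OF assms]])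
  have sub: "carrier ?P \<subseteq> carrier (braid_MCG n)"
    by (auto simp: braid_PMCG_def braid_MCG_def FactGroup_def RCOSETS_def r_coset_def
        RP2_pure_braids_def kernel_def)
  have mult: "x \<otimes>\<^bsub>?P\<^esub> y = x \<otimes>\<^bsub>braid_MCG n\<^esub> y" for x y
    by (simp add: braid_PMCG_def braid_MCG_def set_mult_def)
  have one: "\<one>\<^bsub>?P\<^esub> = \<one>\<^bsub>braid_MCG n\<^esub>"
    by (simp add: braid_PMCG_def braid_MCG_def)
  show ?thesis
    unfolding Let_def torsion_set_eq_image[OF assms]
  proof (rule conjI)
    show "torsion_generated_by ?P ?T \<and> (\<forall>x\<in>?T. group.ord ?P x = 2) \<and>
         G_rank ?P = enat n \<and> NG_rank ?P = enat n \<and> TG_rank ?P = enat n \<and> NTG_rank ?P = enat n \<and>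
         (\<forall>Y. finite Y \<and> card Y < n \<longrightarrow> \<not> normally_generated_by ?P Y)"
      by (rule rank_eq_of_involutions[OF facts(1) fin card facts(2,3) h])
  next
    show "\<forall>X \<phi>. X \<subseteq> topspace RP2 \<and> card X = n \<and> MCG_identification n X \<phi> \<longrightarrow>
           torsion_generated_by (PMCG X) (\<phi> ` ?T) \<and>
           (\<forall>x\<in>\<phi> ` ?T. group.ord (PMCG X) x = 2) \<and>
           G_rank (PMCG X) = enat n \<and> NG_rank (PMCG X) = enat n \<and>
           TG_rank (PMCG X) = enat n \<and> NTG_rank (PMCG X) = enat n \<and>
           (\<forall>Y. finite Y \<and> card Y < n \<longrightarrow> \<not> normally_generated_by (PMCG X) Y)"
    proof (intro allI impI, elim conjE)
      fix X \<phi>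
      assume X: "X \<subseteq> topspace RP2" and \<phi>: "MCG_identification n X \<phi>"
      then have iso: "\<phi> \<in> iso (braid_MCG n) (MCG X)" and img: "\<phi> ` carrier ?P = carrier (PMCG X)"
        by (auto simp: MCG_identification_def)
      \<comment> \<open>The identification restricts to an isomorphism of the pure subgroups, along which the generators
        and the sign homomorphism are transported.\<close>
      have inj: "inj_on \<phi> (carrier ?P)"
        using iso sub by (auto simp: iso_def bij_betw_def intro: inj_on_subset)
      have \<phi>_hom: "\<phi> \<in> hom ?P (PMCG X)"
      proof (rule homI)
        show "\<phi> x \<in> carrier (PMCG X)" if "x \<in> carrier ?P" for x using that img by blast
        show "\<phi> (x \<otimes>\<^bsub>?P\<^esub> y) = \<phi> x \<otimes>\<^bsub>PMCG X\<^esub> \<phi> y"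
          if "x \<in> carrier ?P" "y \<in> carrier ?P" for x y
          using that iso sub hom_mult[of \<phi> "braid_MCG n" "MCG X" x y]
          by (auto simp: iso_def mult PMCG_def)
      qed
      then have \<phi>_iso: "\<phi> \<in> iso ?P (PMCG X)" using inj img by (simp add: iso_def bij_betw_def)
      have "\<phi> \<one>\<^bsub>?P\<^esub> = \<one>\<^bsub>PMCG X\<^esub>"
        using iso_one_MCG[OF M iso X] by (simp add: one PMCG_def)
      then have grp: "group (PMCG X)"
        using P.iso_imp_img_group[OF \<phi>_iso] by (simp add: PMCG_def)
      interpret \<phi>: group_hom ?P "PMCG X" \<phi>
        by (intro group_hom.intro group_hom_axioms.intro P.is_group grp \<phi>_hom)
      have gen: "generated_by (PMCG X) (\<phi> ` ?T)"
        unfolding generated_by_def \<phi>.generate_img[OF TP] genP img[symmetric]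
        using image_mono[OF TP] by (rule conjI) (rule HOL.refl)
      have sq: "t \<otimes>\<^bsub>PMCG X\<^esub> t = \<one>\<^bsub>PMCG X\<^esub>" if t: "t \<in> \<phi> ` ?T" for t
      proof -
        obtain u where u: "t = \<phi> u" "u \<in> ?T" using t by (rule imageE)
        have "u \<in> carrier ?P" using TP u(2) by (rule subsetD)
        then have "t \<otimes>\<^bsub>PMCG X\<^esub> t = \<phi> (u \<otimes>\<^bsub>?P\<^esub> u)" unfolding u(1) by (simp only: \<phi>.hom_mult)
        then show ?thesis by (simp only: facts(3)[OF u(2)] \<phi>.hom_one)
      qed
      let ?g = "h \<circ> inv_into (carrier ?P) \<phi>"
      have g: "?g \<in> hom (PMCG X) (symdiff_group {1..n})"
        using P.iso_set_sym[OF \<phi>_iso] h(1) unfolding iso_def by (blast intro: hom_compose)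
      have "?g ` carrier (PMCG X) = h ` carrier ?P"
        unfolding img[symmetric] image_image using inj by (intro image_cong) simp_all
      then have "?g ` carrier (PMCG X) = Pow {1..n}" using h(2) by simp
      moreover have "finite (\<phi> ` ?T)" using fin by (rule finite_imageI)
      moreover have "card (\<phi> ` ?T) \<le> n"
        by (rule order_trans[OF card_image_le[OF fin] card])
      ultimately show "torsion_generated_by (PMCG X) (\<phi> ` ?T) \<and>
           (\<forall>x\<in>\<phi> ` ?T. group.ord (PMCG X) x = 2) \<and>
           G_rank (PMCG X) = enat n \<and> NG_rank (PMCG X) = enat n \<and>
           TG_rank (PMCG X) = enat n \<and> NTG_rank (PMCG X) = enat n \<and>
           (\<forall>Y. finite Y \<and> card Y < n \<longrightarrow> \<not> normally_generated_by (PMCG X) Y)"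
        by (intro rank_eq_of_involutions[OF grp _ _ gen sq g])
    qed
  qed
qed

end
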